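(* Let $\tau>0$ and consider the delay differential-algebraic equation (DDAE) $F(t,x,\dot x,\sigma_{-\tau}x)=0$ with scalar equations $F_1,\dots,F_M$ and unknown $x=(x_1,\dots,x_n)$, where $(\sigma_{k\tau}f)(t)=f(t+k\tau)$. Let $$\overline\Theta=\{\xi\in\{x_1,\dots,x_n,\dot x_1,\dots,\dot x_n\}\mid \xi\text{ appears in }F\},$$ and let $R_{\mathrm{equal}}$ be the equivalence relation identifying two variables of the form $\sigma_{k\tau}\xi^{(p)}$, $\sigma_{\ell\tau}\xi^{(q)}$ with the same component $\xi\in\{x_1,\dots,x_n\}$. If the DDAE is structurally nonsingular with respect to $\overline\Theta/R_{\mathrm{equal}}$, then the Pantelides algorithm for DDAEs applied to it terminates and determines that no equation is shifted. In this case also the Pantelides algorithm for DAEs, applied to the equation obtained from the DDAE by replacing $\sigma_{-\tau}x$ with a function parameter $\lambda$, terminates, and the resulting graphs of both algorithms are isomorphic.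
   Context: Structural conventions. Only the information which variable appears in which scalar equation is used. Variables are formal symbols $\sigma_{k\tau}\xi^{(p)}$ with $\xi$ an unknown component, $k\in\{-1\}\cup\mathbb N_0$ the order of shift, $p\in\mathbb N_0$ the order of differentiation. Replacing an equation $E$ by its derivative $\dot E$: the variables appearing in $\dot E$ are those $\sigma_{k\tau}\xi^{(p)}$ appearing in $E$ together with the corresponding $\sigma_{k\tau}\xi^{(p+1)}$ (chain rule). Replacing $E$ by the shifted equation $\sigma_\tau E$: the variables appearing in $\sigma_\tau E$ are exactly the $\sigma_{(k+1)\tau}\xi^{(p)}$ for which $\sigma_{k\tau}\xi^{(p)}$ appears in $E$. Structural singularity. Given a system of equations, a set $\Theta$ of variables and an equivalence relation $R$ on $\Theta$, a subset of $m$ of the equations is structurally singular if $m$ is strictly larger than the number of equivalence classes of $R$ restricted to the set of those elements of $\Theta$ that appear in at least one of these $m$ equations. The system is structurally singular with respect to $\Theta/R$ if it contains a structurally singular subset of equations, and structurally nonsingular otherwise. Matchings. A matching in a bipartite graph (equations versus variable vertices) is a set of edges no two of which share a vertex; a vertex in no matching edge is exposed. An alternating path is a path with distinct vertices that starts with a non-matching edge and alternates between non-matching and matching edges. An augmenting path starting in an exposed equation is an alternating path whose last edge is non-matching and which ends in an exposed variable vertex. The Pantelides algorithm for DAEs. Start with the current equations $F_1,\dots,F_M$, the set $V$ of appearing variables $x_i^{(k)}$, and the empty matching. For $r=1,\dots,M$ repeat: (1) Keep only the highest derivatives, i.e. $x_i^{(k)}\in V$ with $x_i^{(k+s)}\notin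 V$ for all $s>0$, and consider the bipartite graph between current equations and highest derivatives (edge if the variable appears in the equation). (2) Search (depth first) for an augmenting path starting in the current $r$-th equation. (3) If one is found, augment the matching along it and continue with $r+1$. (4) Otherwise let $C$ be the set consisting of the $r$-th equation and all equations reachable from it by an alternating path; replace every equation of $C$ by its derivative, add the newly appearing variables to $V$, replace each matching edge between $x_i^{(k)}$ and an equation of $C$ by the edge between $x_i^{(k+1)}$ and the differentiated equation, and repeat with the same $r$. Its output (resulting graph) is the bipartite graph of the final equations versus the present variables. The Pantelides algorithm for DDAEs consists of three steps performed one after the other; it terminates if all of them finish after finitely many operations. Its output (resulting graph) is the bipartite graph of the final equations versus the present variables. Step 1 (shifting step). Variable vertices are the equivalence classes $(\xi,k)$ of all present variables $\sigma_{k\tau}\xi^{(p)}$ with the same $\xi$ and $k$ (any $p$); an equation is adjacent to $(\xi,k)$ if some element of the class appears in it. Start with the current equations $F_1,\dots,F_M$ and the empty matching. For $r=1,\dots,M$, repeat: (1) keep only the classes $(\xi,k)$ that are highest shifts, i.e. $k\ge0$ and no class $(\xi,k')$ with $k'>k$ is present. (2) Search (depth first) for an augmenting path with respect to the current matching starting in the current $r$-th equation. (3) If one is found, augment the matching along it and continue with $r+1$. (4) Otherwise let $C$ be the set consisting of the current $r$-th equation and all equations reachable from it by an alternating path. First perform the "differentiation during the shifting step" (below), then replace every equation of $C$ (in its differentiated form) by its shifted version, add the newly appearing variables, replace each matching edge between $(\xi,k)$ and an equation of $C$ by the edge between $(\xi,k+1)$ and the shifted equation, and repeat with the same $r$. "No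 equation is shifted" means that case (4) never occurs in Step 1. Differentiation during the shifting step. A connection for the exposed $r$-th equation is a set $P$ of alternating paths $(E,v,E')$ with $E,E'\in C$, $\{v,E'\}$ a matching edge, $\{E,v\}$ a non-matching edge, such that each matching edge $\{v,E'\}$ with $E'\in C$ occurs in exactly one path and such that the graph on $C$ with edges $\{E,E'\}$ for $(E,v,E')\in P$ is connected. For every connection $P$ compute the unique minimizer $\nu^P\in\mathbb N_0^{C}$ of $\sum_{E\in C}\nu_E$ subject to $\nu_E-\nu_{E'}=b_{(E,v,E')}$ for all $(E,v,E')\in P$, where $b_{(E,v,E')}$ is the maximal order of differentiation among the elements of $v$ appearing in $E'$ minus the maximal order of differentiation among the elements of $v$ appearing in $E$. Then differentiate each equation $E\in C$ exactly $\max_P\nu^P_E$ times. Step 2 (trimmed linearization). For each component $x_i$ for which $q_i:=\max\{p\mid \sigma_{k\tau}x_i^{(p)}\text{ appears for some }k\ge0\}\ge 2$, let $\ell_p:=\max\{k\mid \sigma_{k\tau}x_i^{(q)}\text{ appears in some equation for some }q\ge p\}$, introduce new unknown components $y_{i_1},\dots,y_{i_{q_i-1}}$, replace $\sigma_{k\tau}x_i^{(p)}$ by $\sigma_{k\tau}y_{i_p}$ for $1\le p<q_i$ and $\sigma_{k\tau}x_i^{(q_i)}$ by $\sigma_{k\tau}\dot y_{i_{q_i-1}}$, and add the equations $\sigma_{\ell_1\tau}\dot x_i=\sigma_{\ell_1\tau}y_{i_1}$ and $\sigma_{\ell_p\tau}\dot y_{i_{p-1}}=\sigma_{\ell_p\tau}y_{i_p}$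 for $2\le p\le q_i-1$. Step 3 (differentiation step). The auxiliary differentiation graph uses only variables $\sigma_{k\tau}\xi^{(p)}$ with $k\ge0$. Its variable vertices are the equivalence classes $[\xi,p]$ of all present variables $\sigma_{k\tau}\xi^{(p)}$, $k\ge0$, with the same $\xi$ and $p$ (any $k\ge 0$); an equation is adjacent to a class if some element of the class appears in it. Then the Pantelides algorithm for DAEs is carried out on this graph (equations resulting from Step 2 in the given order, classes $[\xi,p]$ in place of variables $\xi^{(p)}$), and the same differentiations are performed in the graph of the DDAE. *)

theory Defs
  imports Main
begin

section \<open>Bipartite graphs and alternating paths\<close>

text \<open>Equation vertices are the positions of the equations in a list, counted from 0.\<close>

record 'u bigraph =
  eq_vertices :: "nat set"
  var_vertices :: "'u set"
  edges :: "(nat \<times> 'u) set"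

definition incidence_graph :: "'v set list \<Rightarrow> 'u set \<Rightarrow> ('v set \<Rightarrow> 'u \<Rightarrow> bool) \<Rightarrow> 'u bigraph" where
  "incidence_graph es W adj =
     \<lparr>eq_vertices = {..<length es}, var_vertices = W,
      edges = {(j, w). j < length es \<and> w \<in> W \<and> adj (es ! j) w}\<rparr>"

definition restrict_vars :: "('u \<Rightarrow> bool) \<Rightarrow> 'u bigraph \<Rightarrow> 'u bigraph" where
  "restrict_vars Q G =
     \<lparr>eq_vertices = eq_vertices G, var_vertices = {v \<in> var_vertices G. Q v},
      edges = {(j, v) \<in> edges G. Q v}\<rparr>"

definition isomorphic :: "'u bigraph \<Rightarrow> 'v bigraph \<Rightarrow> bool" where
  "isomorphic G H \<longleftrightarrow>
     (\<exists>f g. bij_betw f (eq_vertices G) (eq_vertices H) \<and>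
            bij_betw g (var_vertices G) (var_vertices H) \<and>
            (\<forall>j\<in>eq_vertices G. \<forall>v\<in>var_vertices G.
               (j, v) \<in> edges G \<longleftrightarrow> (f j, g v) \<in> edges H))"

definition joined :: "(nat \<times> 'u) set \<Rightarrow> nat + 'u \<Rightarrow> nat + 'u \<Rightarrow> bool" where
  "joined A a b \<longleftrightarrow> (\<exists>j v. (j, v) \<in> A \<and> {a, b} = {Inl j, Inr v})"

definition alternating_path :: "'u bigraph \<Rightarrow> (nat \<times> 'u) set \<Rightarrow> (nat + 'u) list \<Rightarrow> bool" where
  "alternating_path G N ps \<longleftrightarrow>
     2 \<le> length ps \<and> distinct ps \<and>
     (\<forall>i. Suc i < length ps \<longrightarrow>
        joined (edges G) (ps ! i) (ps ! Suc i) \<and>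
        (joined N (ps ! i) (ps ! Suc i) \<longleftrightarrow> odd i))"

definition exposed_eq :: "(nat \<times> 'u) set \<Rightarrow> nat \<Rightarrow> bool" where
  "exposed_eq N j \<longleftrightarrow> (\<forall>v. (j, v) \<notin> N)"

definition exposed_var :: "(nat \<times> 'u) set \<Rightarrow> 'u \<Rightarrow> bool" where
  "exposed_var N v \<longleftrightarrow> (\<forall>j. (j, v) \<notin> N)"

definition augmenting_path :: "'u bigraph \<Rightarrow> (nat \<times> 'u) set \<Rightarrow> nat \<Rightarrow> (nat + 'u) list \<Rightarrow> bool" where
  "augmenting_path G N r ps \<longleftrightarrow>
     alternating_path G N ps \<and> hd ps = Inl r \<and> exposed_eq N r \<and>
     \<not> joined N (ps ! (length ps - 2)) (ps ! (length ps - 1)) \<and>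
     (\<exists>v\<in>var_vertices G. last ps = Inr v \<and> exposed_var N v)"

definition path_edges :: "(nat + 'u) list \<Rightarrow> (nat \<times> 'u) set" where
  "path_edges ps = {(j, v). \<exists>i. Suc i < length ps \<and> {ps ! i, ps ! Suc i} = {Inl j, Inr v}}"

definition augment :: "(nat \<times> 'u) set \<Rightarrow> (nat + 'u) list \<Rightarrow> (nat \<times> 'u) set" where
  "augment N ps = (N - path_edges ps) \<union> (path_edges ps - N)"

definition reached :: "'u bigraph \<Rightarrow> (nat \<times> 'u) set \<Rightarrow> nat \<Rightarrow> nat set" where
  "reached G N r =
     insert r {j. \<exists>ps. alternating_path G N ps \<and> hd ps = Inl r \<and> last ps = Inl j}"


section \<open>Runs of nondeterministic algorithms\<close>

text \<open>
  The depth-first searches do not prescribe the order in which neighbours are visited, and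
  depending on that order they may return any augmenting path. The algorithms are therefore
  transition relations in which an arbitrary augmenting path is chosen; termination and all
  statements about results refer to every run.
\<close>

definition terminates :: "('s \<Rightarrow> 's \<Rightarrow> bool) \<Rightarrow> 's \<Rightarrow> bool" where
  "terminates step s \<longleftrightarrow> \<not> (\<exists>f. f 0 = s \<and> (\<forall>i. step (f i) (f (Suc i))))"

definition yields :: "('s \<Rightarrow> 's \<Rightarrow> bool) \<Rightarrow> 's \<Rightarrow> 's \<Rightarrow> bool" where
  "yields step s s' \<longleftrightarrow> step\<^sup>*\<^sup>* s s' \<and> (\<forall>s''. \<not> step s' s'')"

text \<open>
  An equation is represented by the set of variables (of type \<open>'v\<close>) appearing in it.
  The matching uses vertices of type \<open>'u\<close>, which may be classes of variables.
  The field \<open>row\<close> is the index \<open>r\<close> of the loop.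
\<close>

record ('v, 'u) state =
  eqs :: "'v set list"
  present :: "'v set"
  matching :: "(nat \<times> 'u) set"
  row :: nat

definition replace_eqs :: "nat set \<Rightarrow> (nat \<Rightarrow> 'a \<Rightarrow> 'a) \<Rightarrow> 'a list \<Rightarrow> 'a list" where
  "replace_eqs C f es = map (\<lambda>j. if j \<in> C then f j (es ! j) else es ! j) [0..<length es]"

definition replace_edges :: "nat set \<Rightarrow> ('u \<Rightarrow> 'u) \<Rightarrow> (nat \<times> 'u) set \<Rightarrow> (nat \<times> 'u) set" where
  "replace_edges C h N = {(j, v) \<in> N. j \<notin> C} \<union> {(j, h v) | j v. (j, v) \<in> N \<and> j \<in> C}"

definition augment_step ::
  "(('v, 'u) state \<Rightarrow> 'u bigraph) \<Rightarrow> ('v, 'u) state \<Rightarrow> ('v, 'u) state \<Rightarrow> bool" where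
  "augment_step graph s s' \<longleftrightarrow>
     row s < length (eqs s) \<and>
     (\<exists>ps. augmenting_path (graph s) (matching s) (row s) ps \<and>
           s' = s\<lparr>matching := augment (matching s) ps, row := Suc (row s)\<rparr>)"

definition blocked :: "(('v, 'u) state \<Rightarrow> 'u bigraph) \<Rightarrow> ('v, 'u) state \<Rightarrow> bool" where
  "blocked graph s \<longleftrightarrow>
     row s < length (eqs s) \<and>
     \<not> (\<exists>ps. augmenting_path (graph s) (matching s) (row s) ps)"

definition blocked_set :: "(('v, 'u) state \<Rightarrow> 'u bigraph) \<Rightarrow> ('v, 'u) state \<Rightarrow> nat set" where
  "blocked_set graph s = reached (graph s) (matching s) (row s)"


text \<open>Runs end exactly when all rows have been processed.\<close>

lemma augment_step_or_blocked:
  "(\<exists>s'. augment_step graph s s') \<or> blocked graph s \<longleftrightarrow> row s < length (eqs s)"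
  unfolding augment_step_def blocked_def by blast


section \<open>The Pantelides algorithm for DAEs\<close>

text \<open>
  \<open>(c, p)\<close> stands for the \<open>p\<close>-th derivative of \<open>c\<close>. The set \<open>U\<close> contains those \<open>c\<close> that are
  unknown components; all other \<open>c\<close> are function parameters, which are differentiated by the
  chain rule but are not available for the matching.
\<close>

type_synonym 'c dvar = "'c \<times> nat"

definition dae_deriv :: "'c dvar set \<Rightarrow> 'c dvar set" where
  "dae_deriv E = E \<union> {(c, Suc p) | c p. (c, p) \<in> E}"

definition highest_derivatives :: "'c set \<Rightarrow> 'c dvar set \<Rightarrow> 'c dvar set" where
  "highest_derivatives U V = {(c, p) \<in> V. c \<in> U \<and> (\<forall>s>0. (c, p + s) \<notin> V)}"

definition dae_match_graph :: "'c set \<Rightarrow> ('c dvar, 'c dvar) state \<Rightarrow> 'c dvar bigraph" where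
  "dae_match_graph U s =
     incidence_graph (eqs s) (highest_derivatives U (present s)) (\<lambda>E v. v \<in> E)"

definition dae_start :: "'c dvar set list \<Rightarrow> ('c dvar, 'c dvar) state" where
  "dae_start es = \<lparr>eqs = es, present = \<Union>(set es), matching = {}, row = 0\<rparr>"

definition dae_diff_step ::
  "'c set \<Rightarrow> ('c dvar, 'c dvar) state \<Rightarrow> ('c dvar, 'c dvar) state \<Rightarrow> bool" where
  "dae_diff_step U s s' \<longleftrightarrow>
     blocked (dae_match_graph U) s \<and>
     (let C = blocked_set (dae_match_graph U) s;
          es = replace_eqs C (\<lambda>_. dae_deriv) (eqs s)
      in s' = s\<lparr>eqs := es, present := present s \<union> \<Union>(set es),
                matching := replace_edges C (\<lambda>(c, p). (c, Suc p)) (matching s)\<rparr>)"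

definition dae_step ::
  "'c set \<Rightarrow> ('c dvar, 'c dvar) state \<Rightarrow> ('c dvar, 'c dvar) state \<Rightarrow> bool" where
  "dae_step U s s' \<longleftrightarrow> augment_step (dae_match_graph U) s s' \<or> dae_diff_step U s s'"

lemma dae_step_final: "(\<forall>s'. \<not> dae_step U s s') \<longleftrightarrow> length (eqs s) \<le> row s"
  using augment_step_or_blocked[of "dae_match_graph U" s]
  unfolding dae_step_def dae_diff_step_def Let_def by (auto simp: not_less[symmetric])

definition dae_terminates :: "'c set \<Rightarrow> 'c dvar set list \<Rightarrow> bool" where
  "dae_terminates U es \<longleftrightarrow> terminates (dae_step U) (dae_start es)"

definition dae_output :: "'c set \<Rightarrow> 'c dvar set list \<Rightarrow> 'c dvar bigraph \<Rightarrow> bool" where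
  "dae_output U es G \<longleftrightarrow>
     (\<exists>s. yields (dae_step U) (dae_start es) s \<and>
          G = incidence_graph (eqs s) (present s) (\<lambda>E v. v \<in> E))"


section \<open>Delay differential-algebraic equations\<close>

text \<open>
  \<open>X i\<close> is the component \<open>x\<^sub>i\<close> (counted from 0), and \<open>Y i p\<close> is the component \<open>y\<close> with index
  \<open>i\<^sub>p\<close> that the trimmed linearization introduces. The triple \<open>(c, k, p)\<close> is the variable
  obtained from \<open>c\<close> by \<open>p\<close>-fold differentiation and shift by \<open>k\<close> times the delay.
\<close>

datatype comp = X nat | Y nat nat

type_synonym var = "comp \<times> int \<times> nat"

definition is_ddae :: "nat \<Rightarrow> var set list \<Rightarrow> bool" where
  "is_ddae n F \<longleftrightarrow>
     (\<forall>E\<in>set F. E \<subseteq> (\<Union>i<n. {(X i, 0, 0), (X i, 0, 1), (X i, -1, 0)}))"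

definition deriv :: "var set \<Rightarrow> var set" where
  "deriv E = E \<union> {(c, k, Suc p) | c k p. (c, k, p) \<in> E}"

definition shift :: "var set \<Rightarrow> var set" where
  "shift E = {(c, k + 1, p) | c k p. (c, k, p) \<in> E}"

subsection \<open>Structural singularity\<close>

definition singular_subset :: "'v set list \<Rightarrow> 'v set \<Rightarrow> ('v \<times> 'v) set \<Rightarrow> nat set \<Rightarrow> bool" where
  "singular_subset F \<Theta> R S \<longleftrightarrow>
     S \<subseteq> {..<length F} \<and>
     (let A = {v \<in> \<Theta>. \<exists>j\<in>S. v \<in> F ! j} in card (A // (R \<inter> A \<times> A)) < card S)"

definition structurally_nonsingular :: "'v set list \<Rightarrow> 'v set \<Rightarrow> ('v \<times> 'v) set \<Rightarrow> bool" where
  "structurally_nonsingular F \<Theta> R \<longleftrightarrow> \<not> (\<exists>S. singular_subset F \<Theta> R S)"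

definition Theta_bar :: "nat \<Rightarrow> var set list \<Rightarrow> var set" where
  "Theta_bar n F = {v \<in> (\<Union>i<n. {(X i, 0, 0), (X i, 0, 1)}). \<exists>E\<in>set F. v \<in> E}"

definition R_equal :: "var set \<Rightarrow> (var \<times> var) set" where
  "R_equal \<Theta> = {(u, v). u \<in> \<Theta> \<and> v \<in> \<Theta> \<and> fst u = fst v}"

subsection \<open>Shifting step\<close>

text \<open>The pair \<open>(c, k)\<close> is the class of all variables \<open>(c, k, p)\<close>.\<close>

type_synonym shift_class = "comp \<times> int"

definition in_class :: "var set \<Rightarrow> shift_class \<Rightarrow> bool" where
  "in_class E = (\<lambda>(c, k). \<exists>p. (c, k, p) \<in> E)"

definition highest_shifts :: "var set \<Rightarrow> shift_class set" where
  "highest_shifts V =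
     {(c, k). 0 \<le> k \<and> in_class V (c, k) \<and> (\<forall>k'>k. \<not> in_class V (c, k'))}"

definition shift_graph :: "(var, shift_class) state \<Rightarrow> shift_class bigraph" where
  "shift_graph s = incidence_graph (eqs s) (highest_shifts (present s)) in_class"

definition max_order :: "var set \<Rightarrow> shift_class \<Rightarrow> nat" where
  "max_order E = (\<lambda>(c, k). Max {p. (c, k, p) \<in> E})"

text \<open>The triple \<open>(i, v, j)\<close> is the alternating path from equation \<open>i\<close> via \<open>v\<close> to equation \<open>j\<close>.\<close>

definition connection ::
  "shift_class bigraph \<Rightarrow> (nat \<times> shift_class) set \<Rightarrow> nat set \<Rightarrow>
     (nat \<times> shift_class \<times> nat) set \<Rightarrow> bool" where
  "connection G N C P \<longleftrightarrow>
     (\<forall>(i, v, j)\<in>P. i \<in> C \<and> j \<in> C \<and> alternating_path G N [Inl i, Inr v, Inl j]) \<and>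
     (\<forall>(j, v)\<in>N. j \<in> C \<longrightarrow> (\<exists>!i. (i, v, j) \<in> P)) \<and>
     (\<forall>i\<in>C. \<forall>j\<in>C.
        (i, j) \<in> {(a, b). \<exists>v. (a, v, b) \<in> P \<or> (b, v, a) \<in> P}\<^sup>*)"

text \<open>Vectors indexed by \<open>C\<close> are represented by functions that vanish outside \<open>C\<close>.\<close>

definition admissible ::
  "var set list \<Rightarrow> nat set \<Rightarrow> (nat \<times> shift_class \<times> nat) set \<Rightarrow> (nat \<Rightarrow> nat) \<Rightarrow> bool" where
  "admissible es C P \<nu> \<longleftrightarrow>
     (\<forall>i. i \<notin> C \<longrightarrow> \<nu> i = 0) \<and>
     (\<forall>(i, v, j)\<in>P. int (\<nu> i) - int (\<nu> j) = int (max_order (es ! j) v) - int (max_order (es ! i) v))"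

definition minimal_orders ::
  "var set list \<Rightarrow> nat set \<Rightarrow> (nat \<times> shift_class \<times> nat) set \<Rightarrow> nat \<Rightarrow> nat" where
  "minimal_orders es C P =
     (THE \<nu>. admissible es C P \<nu> \<and> (\<forall>\<mu>. admissible es C P \<mu> \<longrightarrow> sum \<nu> C \<le> sum \<mu> C))"

definition diff_orders :: "(var, shift_class) state \<Rightarrow> nat set \<Rightarrow> nat \<Rightarrow> nat" where
  "diff_orders s C j =
     Max {minimal_orders (eqs s) C P j | P. connection (shift_graph s) (matching s) C P}"

definition ddae_start :: "var set list \<Rightarrow> (var, shift_class) state" where
  "ddae_start F = \<lparr>eqs = F, present = \<Union>(set F), matching = {}, row = 0\<rparr>"

definition shift_eqs_step ::
  "(var, shift_class) state \<Rightarrow> (var, shift_class) state \<Rightarrow> bool" where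
  "shift_eqs_step s s' \<longleftrightarrow>
     blocked shift_graph s \<and>
     (let C = blocked_set shift_graph s;
          es = replace_eqs C (\<lambda>j E. shift ((deriv ^^ diff_orders s C j) E)) (eqs s)
      in s' = s\<lparr>eqs := es, present := present s \<union> \<Union>(set es),
                matching := replace_edges C (\<lambda>(c, k). (c, k + 1)) (matching s)\<rparr>)"

definition shifting_step ::
  "(var, shift_class) state \<Rightarrow> (var, shift_class) state \<Rightarrow> bool" where
  "shifting_step s s' \<longleftrightarrow> augment_step shift_graph s s' \<or> shift_eqs_step s s'"

lemma shifting_step_final: "(\<forall>s'. \<not> shifting_step s s') \<longleftrightarrow> length (eqs s) \<le> row s"
  using augment_step_or_blocked[of shift_graph s]
  unfolding shifting_step_def shift_eqs_step_def Let_def by (auto simp: not_less[symmetric])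

definition no_equation_shifted :: "var set list \<Rightarrow> bool" where
  "no_equation_shifted F \<longleftrightarrow>
     \<not> (\<exists>s s'. shifting_step\<^sup>*\<^sup>* (ddae_start F) s \<and> shift_eqs_step s s')"

subsection \<open>Trimmed linearization\<close>

text \<open>
  From here on a DDAE is given by the list of its equations and the set of present variables.
\<close>

type_synonym system = "var set list \<times> var set"

text \<open>The value is 0 if no variable of the component appears.\<close>

definition top_order :: "var set list \<Rightarrow> nat \<Rightarrow> nat" where
  "top_order es i = Max (insert 0 {p. \<exists>k\<ge>0. \<exists>E\<in>set es. (X i, k, p) \<in> E})"

definition top_shift :: "var set list \<Rightarrow> nat \<Rightarrow> nat \<Rightarrow> int" where
  "top_shift es i p = Max {k. \<exists>q\<ge>p. \<exists>E\<in>set es. (X i, k, q) \<in> E}"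

definition lin_var :: "var set list \<Rightarrow> var \<Rightarrow> var" where
  "lin_var es v =
     (case v of
        (X i, k, p) \<Rightarrow>
          (let q = top_order es i in
           if 2 \<le> q \<and> 1 \<le> p \<and> p < q then (Y i p, k, 0)
           else if 2 \<le> q \<and> p = q then (Y i (q - 1), k, 1)
           else v)
      | _ \<Rightarrow> v)"

definition lin_eqs :: "var set list \<Rightarrow> nat \<Rightarrow> var set list" where
  "lin_eqs es i =
     (let q = top_order es i; l = top_shift es i in
      if 2 \<le> q
      then {(X i, l 1, 1), (Y i 1, l 1, 0)} #
           map (\<lambda>p. {(Y i (p - 1), l p, 1), (Y i p, l p, 0)}) [2..<q]
      else [])"

definition trimmed_linearization :: "nat \<Rightarrow> system \<Rightarrow> system" where
  "trimmed_linearization n =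
     (\<lambda>(es, V).
        let es' = map ((`) (lin_var es)) es @ concat (map (lin_eqs es) [0..<n])
        in (es', lin_var es ` V \<union> \<Union>(set es')))"

subsection \<open>Differentiation step\<close>

text \<open>
  The auxiliary differentiation graph has the classes \<open>[c, p]\<close>, represented by the pairs
  \<open>(c, p)\<close>, as variable vertices. A state consists of the DDAE and of the state of the Pantelides
  algorithm for DAEs running on the auxiliary graph.
\<close>

type_synonym diff_state = "system \<times> (comp dvar, comp dvar) state"

definition order_classes :: "var set \<Rightarrow> comp dvar set" where
  "order_classes E = {(c, p). \<exists>k\<ge>0. (c, k, p) \<in> E}"

definition diff_start :: "system \<Rightarrow> diff_state" where
  "diff_start D =
     (D, \<lparr>eqs = map order_classes (fst D), present = order_classes (snd D),
          matching = {}, row = 0\<rparr>)"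

definition diff_system :: "nat set \<Rightarrow> system \<Rightarrow> system" where
  "diff_system C =
     (\<lambda>(es, V). let es' = replace_eqs C (\<lambda>_. deriv) es in (es', V \<union> \<Union>(set es')))"

definition differentiation_step :: "diff_state \<Rightarrow> diff_state \<Rightarrow> bool" where
  "differentiation_step = (\<lambda>(D, s) (D', s').
     augment_step (dae_match_graph UNIV) s s' \<and> D' = D \<or>
     dae_diff_step UNIV s s' \<and> D' = diff_system (blocked_set (dae_match_graph UNIV) s) D)"

lemma differentiation_step_final:
  "(\<forall>T. \<not> differentiation_step (D, s) T) \<longleftrightarrow> length (eqs s) \<le> row s"
proof -
  have "(\<exists>T. differentiation_step (D, s) T) \<longleftrightarrow> (\<exists>s'. dae_step UNIV s s')"
    unfolding differentiation_step_def dae_step_def split_paired_Ex[where 'a = system] prod.case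
    by blast
  then show ?thesis
    using dae_step_final[of UNIV s] by blast
qed

subsection \<open>The Pantelides algorithm for DDAEs\<close>

definition after_linearization :: "nat \<Rightarrow> (var, shift_class) state \<Rightarrow> diff_state" where
  "after_linearization n s = diff_start (trimmed_linearization n (eqs s, present s))"

definition ddae_terminates :: "nat \<Rightarrow> var set list \<Rightarrow> bool" where
  "ddae_terminates n F \<longleftrightarrow>
     terminates shifting_step (ddae_start F) \<and>
     (\<forall>s. yields shifting_step (ddae_start F) s \<longrightarrow>
          terminates differentiation_step (after_linearization n s))"

definition ddae_output :: "nat \<Rightarrow> var set list \<Rightarrow> var bigraph \<Rightarrow> bool" where
  "ddae_output n F G \<longleftrightarrow>
     (\<exists>s es V a.
        yields shifting_step (ddae_start F) s \<and>
        yields differentiation_step (after_linearization n s) ((es, V), a) \<and>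
        G = incidence_graph es V (\<lambda>E v. v \<in> E))"

subsection \<open>Replacing the delayed unknown by a function parameter\<close>

text \<open>
  The graph of the DAE with parameter has the derivatives of the unknown and, as counterparts of
  the delayed variables, those of the parameter as variable vertices. Restricting it by
  \<open>is_unknown\<close> gives the graph in which the parameter is not regarded as a variable; the
  corresponding part of the DDAE graph is obtained by \<open>is_undelayed\<close>.
\<close>

datatype symbol = Unknown comp | Parameter comp

definition replace_delayed :: "var set list \<Rightarrow> symbol dvar set list" where
  "replace_delayed F =
     map ((`) (\<lambda>(c, k, p). (if k = -1 then Parameter c else Unknown c, p))) F"

definition is_undelayed :: "var \<Rightarrow> bool" where
  "is_undelayed = (\<lambda>(c, k, p). 0 \<le> k)"

definition is_unknown :: "symbol dvar \<Rightarrow> bool" where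
  "is_unknown = (\<lambda>(c, p). c \<in> range Unknown)"

end

theory Submission
  imports Defs
begin

text \<open>
  A blocked row can be described without the matching: there is no augmenting path iff some set of
  equations up to the current row has too few neighbours, and the reached equations then form the
  least such set. For the shifting step this contradicts structural nonsingularity, which is Hall's
  condition for the classes of variables with shift 0. As no order above 1 appears, the linearization
  changes nothing. The differentiation step and the algorithm for the DAE with parameter work on
  isomorphic matching graphs, and since their blocked sets depend on these graphs only, all their
  runs stay in step, whatever augmenting paths are chosen.
\<close>

section \<open>Augmenting paths and deficient sets\<close>

text \<open>The order of search is free, so after equally many steps the two algorithms may hold
  unrelated matchings, and no map between their states can respect the matchings. Only data
  determined by graph and row can be compared, hence the passage to deficient sets. The counting
  behind it needs a matching of exactly the processed rows into the current highest derivatives.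
  That differentiation preserves this is not automatic: it rests on the closure of a blocked set
  under matched neighbours. Structural nonsingularity enters twice. It excludes shifts, and it
  bounds the differentiations: Hall's condition between equations and components ignores orders, so
  differentiation cannot destroy it, whereas Hall's condition for highest derivatives may fail at
  intermediate states. Delayed variables are never matched but are differentiated along with their
  equations, so the set of differentiated equations determines them as well. Since only the shifts
  -1 and 0 occur, each class of the auxiliary graph contains a single variable.\<close>

text \<open>\<open>Domain N = {..<r}\<close> describes the loop on arrival at row \<open>r\<close>:
  all earlier equations are matched and row \<open>r\<close> is exposed.\<close>

definition row_matching :: "(nat \<times> 'u) set \<Rightarrow> (nat \<times> 'u) set \<Rightarrow> nat \<Rightarrow> bool" where
  "row_matching A N r \<longleftrightarrow>
     N \<subseteq> A \<and> Domain N = {..<r} \<and> single_valued N \<and> single_valued (N\<inverse>)"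

text \<open>A violator of Hall's condition among the rows up to \<open>r\<close>. Later rows are
  excluded because they are unmatched and no trail from \<open>r\<close> reaches them.\<close>

definition deficient :: "(nat \<times> 'u) set \<Rightarrow> nat \<Rightarrow> nat set \<Rightarrow> bool" where
  "deficient A r S \<longleftrightarrow> S \<subseteq> {..r} \<and> card (A `` S) < card S"

text \<open>Unlike \<open>alternating_path\<close>, a single vertex is allowed, so that
  \<open>r\<close> is reached by a trail too and the \<open>insert\<close> in \<open>reached\<close>
  needs no separate treatment.\<close>

definition trail :: "'u bigraph \<Rightarrow> (nat \<times> 'u) set \<Rightarrow> nat \<Rightarrow> (nat + 'u) list \<Rightarrow> bool" where
  "trail G N r ps \<longleftrightarrow>
     ps \<noteq> [] \<and> hd ps = Inl r \<and> distinct ps \<and>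
     (\<forall>i. Suc i < length ps \<longrightarrow>
        joined (edges G) (ps ! i) (ps ! Suc i) \<and>
        (joined N (ps ! i) (ps ! Suc i) \<longleftrightarrow> odd i))"

section \<open>Vertices and prefixes of trails\<close>

lemma joined_simps [simp]:
  "joined A (Inl j) (Inr v) \<longleftrightarrow> (j, v) \<in> A"
  "joined A (Inr v) (Inl j) \<longleftrightarrow> (j, v) \<in> A"
  "\<not> joined A (Inl j) (Inl k)"
  "\<not> joined A (Inr v) (Inr w)"
  unfolding joined_def by (auto simp: doubleton_eq_iff)

lemma trail_iff_alternating_path:
  "2 \<le> length ps \<and> trail G N r ps \<longleftrightarrow> alternating_path G N ps \<and> hd ps = Inl r"
  unfolding trail_def alternating_path_def by auto

lemma reached_eq_trail: "reached G N r = {j. \<exists>ps. trail G N r ps \<and> last ps = Inl j}"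
proof (intro set_eqI iffI)
  fix j assume "j \<in> reached G N r"
  then consider "j = r" | ps where "alternating_path G N ps" "hd ps = Inl r" "last ps = Inl j"
    unfolding reached_def by blast
  then show "j \<in> {j. \<exists>ps. trail G N r ps \<and> last ps = Inl j}"
  proof cases
    case 1
    then have "trail G N r [Inl r] \<and> last [Inl r] = Inl j" by (simp add: trail_def)
    then show ?thesis by blast
  next
    case 2
    then show ?thesis using trail_iff_alternating_path[of ps G N r] by blast
  qed
next
  fix j assume "j \<in> {j. \<exists>ps. trail G N r ps \<and> last ps = Inl j}"
  then obtain ps where ps: "trail G N r ps" "last ps = Inl j" by blast
  show "j \<in> reached G N r"
  proof (cases "2 \<le> length ps")
    case True
    then show ?thesis using ps trail_iff_alternating_path[of ps G N r]
      unfolding reached_def by blast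
  next
    case False
    then obtain x where "ps = [x]"
      using ps(1) unfolding trail_def by (cases ps; cases "tl ps") auto
    then show ?thesis using ps unfolding trail_def reached_def by simp
  qed
qed

lemma trail_vertex:
  assumes "trail G N r ps" "i < length ps"
  shows "isl (ps ! i) \<longleftrightarrow> even i"
  using assms(2)
proof (induction i)
  case 0
  then show ?case using assms(1) by (simp add: trail_def hd_conv_nth)
next
  case (Suc i)
  then have "joined (edges G) (ps ! i) (ps ! Suc i)" "isl (ps ! i) \<longleftrightarrow> even i"
    using assms(1) by (auto simp: trail_def)
  then show ?case by (cases "ps ! i"; cases "ps ! Suc i") auto
qed

lemma trail_take: "trail G N r ps \<Longrightarrow> 0 < m \<Longrightarrow> trail G N r (take m ps)"
  unfolding trail_def by auto

lemma trail_snoc: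
  assumes "trail G N r ps" "x \<notin> set ps" "joined (edges G) (last ps) x"
    "joined N (last ps) x \<longleftrightarrow> even (length ps)"
  shows "trail G N r (ps @ [x])"
proof -
  have ne: "ps \<noteq> []" using assms(1) by (simp add: trail_def)
  have "joined (edges G) ((ps @ [x]) ! i) ((ps @ [x]) ! Suc i) \<and>
        (joined N ((ps @ [x]) ! i) ((ps @ [x]) ! Suc i) \<longleftrightarrow> odd i)"
    if "Suc i < length (ps @ [x])" for i
  proof (cases "Suc i < length ps")
    case True
    then show ?thesis using assms(1) by (simp add: trail_def nth_append)
  next
    case False
    then have i: "Suc i = length ps" using that by simp
    then have "(ps @ [x]) ! i = last ps" "(ps @ [x]) ! Suc i = x"
      using ne by (simp_all add: nth_append last_conv_nth flip: i)
    then show ?thesis using assms(3,4) by (simp flip: i)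
  qed
  then show ?thesis using assms(1,2) unfolding trail_def by auto
qed

text \<open>Equations sit at even positions, so any equation but the first is entered through an
  edge with odd index, which is a matching edge.\<close>

lemma trail_eq_matched:
  assumes "trail G N r ps" "0 < i" "i < length ps" "ps ! i = Inl j"
  obtains v where "ps ! (i - 1) = Inr v" "(j, v) \<in> N"
proof -
  have ev: "even i" using trail_vertex[OF assms(1,3)] assms(4) by simp
  then have "odd (i - 1)" "i - 1 < length ps" using assms(2,3) by auto
  then have "\<not> isl (ps ! (i - 1))" using trail_vertex[OF assms(1)] by blast
  then obtain v where v: "ps ! (i - 1) = Inr v" by (cases "ps ! (i - 1)") auto
  have "joined N (ps ! (i - 1)) (ps ! Suc (i - 1))"
    using assms(1-3) \<open>odd (i - 1)\<close> unfolding trail_def by (metis Suc_pred')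
  then show ?thesis using that v assms(2,4) by simp
qed

lemma trail_var_matched:
  assumes "trail G N r ps" "Suc i < length ps" "ps ! i = Inr v"
  obtains j where "ps ! Suc i = Inl j" "(j, v) \<in> N"
proof -
  have "odd i" using trail_vertex[OF assms(1), of i] assms(2,3) by simp
  then have "joined N (Inr v) (ps ! Suc i)" using assms unfolding trail_def by metis
  then show ?thesis using that by (cases "ps ! Suc i") auto
qed

lemma trail_eq_reached:
  assumes "trail G N r ps" "i < length ps" "ps ! i = Inl j"
  shows "j \<in> reached G N r"
proof -
  have "last (take (Suc i) ps) = Inl j" using assms(2,3) by (simp add: take_Suc_conv_app_nth)
  then show ?thesis using trail_take[OF assms(1), of "Suc i"] unfolding reached_eq_trail by blast
qed

section \<open>Matchings that cover the rows already processed\<close>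

lemma row_matching_unique:
  assumes "row_matching A N r"
  shows "(j, v) \<in> N \<Longrightarrow> (j, w) \<in> N \<Longrightarrow> v = w" "(j, v) \<in> N \<Longrightarrow> (k, v) \<in> N \<Longrightarrow> j = k"
    "(j, v) \<in> N \<Longrightarrow> j < r" "(j, v) \<in> N \<Longrightarrow> (j, v) \<in> A"
  using assms unfolding row_matching_def single_valued_def by blast+

text \<open>The easy half of Hall's theorem: choosing partners is injective on
  \<open>S\<close>.\<close>

lemma row_matching_card_le:
  assumes "row_matching A N r" "finite A" "S \<subseteq> {..<r}"
  shows "card S \<le> card (N `` S)" "card S \<le> card (A `` S)"
proof -
  have "\<forall>j\<in>S. \<exists>v. (j, v) \<in> N" using assms(1,3) unfolding row_matching_def by blast
  then obtain h where h: "\<And>j. j \<in> S \<Longrightarrow> (j, h j) \<in> N" by metis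
  have "inj_on h S" using h row_matching_unique(2)[OF assms(1)] by (metis inj_onI)
  then have "card S = card (h ` S)" by (simp add: card_image)
  moreover have "h ` S \<subseteq> N `` S" using h by blast
  moreover have NA: "N `` S \<subseteq> A `` S" using assms(1) unfolding row_matching_def by blast
  moreover have fin: "finite (A `` S)" using assms(2) by (rule finite_Image)
  ultimately show "card S \<le> card (N `` S)"
    using card_mono[of "N `` S" "h ` S"] finite_subset by metis
  then show "card S \<le> card (A `` S)" using card_mono[OF fin NA] by linarith
qed

lemma reached_subset:
  assumes "row_matching (edges G) N r"
  shows "reached G N r \<subseteq> {..r}"
proof
  fix j assume "j \<in> reached G N r"
  then obtain ps where ps: "trail G N r ps" "last ps = Inl j"
    unfolding reached_eq_trail by blast
  show "j \<in> {..r}"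
  proof (cases "length ps = 1")
    case True
    then show ?thesis using ps by (auto simp: trail_def length_Suc_conv)
  next
    case False
    then have "0 < length ps - 1" "length ps - 1 < length ps" "ps ! (length ps - 1) = Inl j"
      using ps by (auto simp: trail_def last_conv_nth Suc_lessI)
    then obtain v where "(j, v) \<in> N" using trail_eq_matched[OF ps(1)] by blast
    then show ?thesis using row_matching_unique(3)[OF assms] by force
  qed
qed

section \<open>The reached equations as the least closed set\<close>

lemma row_mem_reached: "r \<in> reached G N r"
  by (simp add: reached_def)

text \<open>Take a trail to \<open>j\<close>. If \<open>v\<close> lies on it, its successor is its
  partner. Otherwise the trail extends to \<open>v\<close>; an exposed \<open>v\<close> would
  complete an augmenting path, so \<open>v\<close> has a partner, by which the trail extends once
  more.\<close>

lemma reached_closed: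
  assumes M: "row_matching (edges G) N r"
    and G: "Range (edges G) \<subseteq> var_vertices G"
    and no_aug: "\<nexists>ps. augmenting_path G N r ps"
    and j: "j \<in> reached G N r" and e: "(j, v) \<in> edges G"
  shows "\<exists>j'\<in>reached G N r. (j', v) \<in> N"
proof -
  obtain ps where ps: "trail G N r ps" "last ps = Inl j"
    using j unfolding reached_eq_trail by blast
  have ne: "ps \<noteq> []" using ps by (simp add: trail_def)
  have lst: "ps ! (length ps - 1) = Inl j" using ps(2) ne by (simp add: last_conv_nth)
  have odd_len: "odd (length ps)"
    using trail_vertex[OF ps(1), of "length ps - 1"] ne lst by auto
  have r: "(r, w) \<notin> N" for w using row_matching_unique(3)[OF M, of r w] by auto
  \<comment> \<open>An equation on the trail is entered from its partner, and the start has none.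
    Contrapositively, the partner of a variable off the trail is off the trail as well, which keeps
    the extended trail free of repetitions.\<close>
  have in_path: "Inr w \<in> set ps" if kw: "(k, w) \<in> N" and "Inl k \<in> set ps" for k w
  proof -
    obtain i where i: "i < length ps" "ps ! i = Inl k"
      using \<open>Inl k \<in> set ps\<close> unfolding in_set_conv_nth by blast
    have "i \<noteq> 0" using i ps(1) kw r[of w] by (cases i) (auto simp: trail_def hd_conv_nth)
    then obtain w' where "ps ! (i - 1) = Inr w'" "(k, w') \<in> N"
      using trail_eq_matched[OF ps(1) _ i] by blast
    moreover from this have "w' = w" using kw row_matching_unique(1)[OF M] by blast
    ultimately show ?thesis using i(1) nth_mem[of "i - 1" ps] by simp
  qed
  show ?thesis
  proof (cases "Inr v \<in> set ps")
    case True
    then obtain i where i: "i < length ps" "ps ! i = Inr v" unfolding in_set_conv_nth by blast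
    moreover from i lst have "i \<noteq> length ps - 1" by auto
    ultimately have len: "Suc i < length ps" by linarith
    then obtain k where "ps ! Suc i = Inl k" "(k, v) \<in> N"
      using trail_var_matched[OF ps(1) _ i(2)] by blast
    then show ?thesis using trail_eq_reached[OF ps(1) len] by blast
  next
    case False
    have "Inl j \<in> set ps" using ps(2) ne last_in_set by metis
    then have "(j, v) \<notin> N" using in_path False by blast
    then have ps1: "trail G N r (ps @ [Inr v])"
      using trail_snoc[OF ps(1) False] ps(2) e odd_len by simp
    have "\<not> exposed_var N v"
    proof
      assume ex: "exposed_var N v"
      have "2 \<le> length (ps @ [Inr v])" using ne by (cases ps) auto
      then have "alternating_path G N (ps @ [Inr v])" "hd (ps @ [Inr v]) = Inl r"
        using ps1 trail_iff_alternating_path[of "ps @ [Inr v]" G N r] by blast+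
      moreover have "exposed_eq N r" using r by (simp add: exposed_eq_def)
      moreover have "(ps @ [Inr v]) ! (length ps - 1) = Inl j"
        using lst ne by (simp add: nth_append)
      moreover have "v \<in> var_vertices G" using e G by blast
      ultimately have "augmenting_path G N r (ps @ [Inr v])"
        using ex \<open>(j, v) \<notin> N\<close> unfolding augmenting_path_def by simp
      then show False using no_aug by blast
    qed
    then obtain k where k: "(k, v) \<in> N" unfolding exposed_var_def by blast
    then have "Inl k \<notin> set ps" using in_path False by blast
    then have "trail G N r ((ps @ [Inr v]) @ [Inl k])"
      using k odd_len row_matching_unique(4)[OF M k] by (intro trail_snoc ps1) auto
    then have "k \<in> reached G N r"
      unfolding reached_eq_trail using last_snoc[of "ps @ [Inr v]" "Inl k"] by blast
    then show ?thesis using k by blast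
  qed
qed

text \<open>A trail that starts in \<open>S\<close> cannot leave it: the variable after an equation
  of \<open>S\<close> has its unique partner in \<open>S\<close>, and that partner is the next
  vertex.\<close>

lemma reached_least:
  assumes M: "row_matching (edges G) N r" and "r \<in> S"
    and closed: "\<And>j v. j \<in> S \<Longrightarrow> (j, v) \<in> edges G \<Longrightarrow> \<exists>j'\<in>S. (j', v) \<in> N"
  shows "reached G N r \<subseteq> S"
proof
  fix j assume "j \<in> reached G N r"
  then obtain ps where ps: "trail G N r ps" "last ps = Inl j"
    unfolding reached_eq_trail by blast
  have ne: "ps \<noteq> []" using ps by (simp add: trail_def)
  have "2 * m < length ps \<Longrightarrow> \<exists>k\<in>S. ps ! (2 * m) = Inl k" for m
  proof (induction m)
    case 0
    then show ?case using ps(1) \<open>r \<in> S\<close> by (auto simp: trail_def hd_conv_nth)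
  next
    case (Suc m)
    then obtain k where k: "k \<in> S" "ps ! (2 * m) = Inl k" by auto
    have len: "Suc (Suc (2 * m)) < length ps" using Suc.prems by simp
    then have "joined (edges G) (ps ! (2 * m)) (ps ! Suc (2 * m))"
      using ps(1) by (simp add: trail_def)
    then obtain v where v: "ps ! Suc (2 * m) = Inr v" "(k, v) \<in> edges G"
      using k(2) by (cases "ps ! Suc (2 * m)") auto
    then obtain k' where k': "ps ! Suc (Suc (2 * m)) = Inl k'" "(k', v) \<in> N"
      using trail_var_matched[OF ps(1) len] by blast
    moreover obtain k'' where "k'' \<in> S" "(k'', v) \<in> N" using closed k(1) v(2) by blast
    ultimately have "k' \<in> S" using row_matching_unique(2)[OF M] by blast
    then show ?case using k'(1) by simp
  qed
  moreover have "even (length ps - 1)"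
    using trail_vertex[OF ps(1), of "length ps - 1"] ne ps(2) by (simp add: last_conv_nth)
  moreover have "length ps - 1 < length ps" using ne by simp
  ultimately show "j \<in> S" using ps(2) ne by (metis evenE last_conv_nth sum.inject(1))
qed

text \<open>By closure, every neighbour of the reached set has its partner there, and the partner is
  not the exposed \<open>r\<close>. Hence the neighbours inject into the reached set without
  \<open>r\<close>.\<close>

lemma deficient_reached:
  assumes M: "row_matching (edges G) N r" and G: "Range (edges G) \<subseteq> var_vertices G"
    and no_aug: "\<nexists>ps. augmenting_path G N r ps"
  shows "deficient (edges G) r (reached G N r)"
proof -
  let ?C = "reached G N r"
  have fC: "finite ?C" using finite_subset[OF reached_subset[OF M]] by simp
  define h where "h v = (THE j. (j, v) \<in> N)" for v
  have h: "h v = j" if "(j, v) \<in> N" for j v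
    unfolding h_def using that row_matching_unique(2)[OF M] by blast
  have "\<exists>j\<in>?C - {r}. (j, v) \<in> N" if "v \<in> edges G `` ?C" for v
    using that reached_closed[OF M G no_aug] row_matching_unique(3)[OF M] by blast
  then have mem: "h v \<in> ?C - {r} \<and> (h v, v) \<in> N" if "v \<in> edges G `` ?C" for v
    using that h by blast
  then have "inj_on h (edges G `` ?C)"
    using row_matching_unique(1)[OF M] by (metis inj_onI)
  then have "card (edges G `` ?C) \<le> card (?C - {r})"
    using mem fC by (intro card_inj_on_le) auto
  also have "\<dots> < card ?C"
    using fC row_mem_reached by (intro psubset_card_mono) auto
  finally show ?thesis using reached_subset[OF M] by (simp add: deficient_def)
qed

text \<open>A deficient \<open>S\<close> contains \<open>r\<close>, since the earlier rows are
  matched. Then the partners of \<open>S - {r}\<close> already number at least as many as all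
  neighbours of \<open>S\<close>, so they are all of them. Thus \<open>S\<close> is closed in the
  sense of \<open>reached_least\<close>.\<close>

lemma reached_subset_deficient:
  assumes M: "row_matching (edges G) N r" and fin: "finite (edges G)"
    and S: "deficient (edges G) r S"
  shows "reached G N r \<subseteq> S"
proof (rule reached_least[OF M])
  have fS: "finite S" using S finite_subset[of S "{..r}"] by (simp add: deficient_def)
  have less: "S - {r} \<subseteq> {..<r}" using S by (auto simp: deficient_def)
  show "r \<in> S"
  proof (rule ccontr)
    assume "r \<notin> S"
    then show False using row_matching_card_le(2)[OF M fin less] S by (simp add: deficient_def)
  qed
  then have "card S = Suc (card (S - {r}))" using card_Suc_Diff1[OF fS] by simp
  then have "card (edges G `` S) \<le> card (N `` (S - {r}))"
    using row_matching_card_le(1)[OF M fin less] S by (simp add: deficient_def)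
  moreover have "N `` (S - {r}) \<subseteq> edges G `` S" using row_matching_unique(4)[OF M] by blast
  ultimately have "N `` (S - {r}) = edges G `` S"
    using card_seteq[OF finite_Image[OF fin]] by blast
  then show "\<exists>j'\<in>S. (j', v) \<in> N" if "j \<in> S" "(j, v) \<in> edges G" for j v
    using that by blast
qed

section \<open>Augmentation and Hall's condition\<close>

text \<open>Write the path as \<open>j 0, v 0, ..., j m, v m\<close> with \<open>j 0 = r\<close> and
  \<open>v m\<close> exposed. The symmetric difference exchanges the \<open>m\<close> edges
  \<open>(j (Suc i), v i)\<close> for the \<open>m + 1\<close> edges
  \<open>(j i, v i)\<close>.\<close>

lemma row_matching_augment:
  assumes M: "row_matching (edges G) N r" and aug: "augmenting_path G N r ps"
  shows "row_matching (edges G) (augment N ps) (Suc r)"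
proof -
  have tr: "trail G N r ps"
    using aug trail_iff_alternating_path[of ps G N r] unfolding augmenting_path_def by blast
  have ne: "ps \<noteq> []" using tr by (simp add: trail_def)
  obtain u where u: "last ps = Inr u" "exposed_var N u"
    using aug unfolding augmenting_path_def by blast
  have "odd (length ps - 1)"
    using trail_vertex[OF tr, of "length ps - 1"] u(1) ne by (simp add: last_conv_nth)
  then obtain m where "length ps - 1 = 2 * m + 1" by (rule oddE)
  then have len: "length ps = Suc (Suc (2 * m))" by simp
  define j where "j i = projl (ps ! (2 * i))" for i
  define v where "v i = projr (ps ! Suc (2 * i))" for i
  have pj: "ps ! (2 * i) = Inl (j i)" if "i \<le> m" for i
    using trail_vertex[OF tr, of "2 * i"] that len unfolding j_def by simp
  have pv: "ps ! Suc (2 * i) = Inr (v i)" if "i \<le> m" for i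
    using trail_vertex[OF tr, of "Suc (2 * i)"] that len unfolding v_def by simp
  have dist: "distinct ps" using tr by (simp add: trail_def)
  have injj: "i = k" if "i \<le> m" "k \<le> m" "j i = j k" for i k
    using nth_eq_iff_index_eq[OF dist, of "2 * i" "2 * k"] that pj len by simp
  have injv: "i = k" if "i \<le> m" "k \<le> m" "v i = v k" for i k
    using nth_eq_iff_index_eq[OF dist, of "Suc (2 * i)" "Suc (2 * k)"] that pv len by simp
  have step: "joined (edges G) (ps ! i) (ps ! Suc i) \<and>
      (joined N (ps ! i) (ps ! Suc i) \<longleftrightarrow> odd i)" if "Suc i < length ps" for i
    using tr that by (simp add: trail_def)
  have new: "(j i, v i) \<in> edges G" "(j i, v i) \<notin> N" if "i \<le> m" for i
    using step[of "2 * i"] that len pj pv by auto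
  have old: "(j (Suc i), v i) \<in> N" if "i < m" for i
    using step[of "Suc (2 * i)"] that len pj[of "Suc i"] pv[of i] by auto
  have j0: "j 0 = r" using pj[of 0] tr ne by (simp add: trail_def hd_conv_nth)
  have vm: "v m = u" using pv[of m] u(1) len ne by (simp add: last_conv_nth)
  have "(a, w) \<in> path_edges ps \<longleftrightarrow>
      (\<exists>i\<le>m. (a, w) = (j i, v i)) \<or> (\<exists>i<m. (a, w) = (j (Suc i), v i))" (is "?L \<longleftrightarrow> ?R") for a w
  proof
    assume ?L
    then obtain i where i: "Suc i < length ps" "{ps ! i, ps ! Suc i} = {Inl a, Inr w}"
      unfolding path_edges_def by blast
    show ?R
    proof (cases "even i")
      case True
      then obtain k where "i = 2 * k" by blast
      then have "k \<le> m" "ps ! i = Inl (j k)" "ps ! Suc i = Inr (v k)"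
        using i(1) len pj[of k] pv[of k] by auto
      then show ?thesis using i(2) by (auto simp: doubleton_eq_iff)
    next
      case False
      then obtain k where k: "i = 2 * k + 1" by (rule oddE)
      then have "k < m" "ps ! i = Inr (v k)" "ps ! Suc i = Inl (j (Suc k))"
        using i(1) len pj[of "Suc k"] pv[of k] by auto
      then show ?thesis using i(2) by (auto simp: doubleton_eq_iff)
    qed
  next
    assume ?R
    then show ?L
    proof (elim disjE exE conjE)
      fix i assume "i \<le> m" "(a, w) = (j i, v i)"
      then have "Suc (2 * i) < length ps \<and> {ps ! (2 * i), ps ! Suc (2 * i)} = {Inl a, Inr w}"
        using len pj pv by simp
      then show ?L unfolding path_edges_def by blast
    next
      fix i assume "i < m" "(a, w) = (j (Suc i), v i)"
      then have "Suc (Suc (2 * i)) < length ps \<and>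
          {ps ! Suc (2 * i), ps ! Suc (Suc (2 * i))} = {Inl a, Inr w}"
        using len pj[of "Suc i"] pv[of i] by auto
      then show ?L unfolding path_edges_def by blast
    qed
  qed
  then have aug_iff: "(a, w) \<in> augment N ps \<longleftrightarrow>
      (a, w) \<in> N \<and> (\<forall>i<m. (a, w) \<noteq> (j (Suc i), v i)) \<or> (\<exists>i\<le>m. (a, w) = (j i, v i))" for a w
    unfolding augment_def using new(2) old by (auto simp: less_imp_le)
  note uniq = row_matching_unique[OF M]
  \<comment> \<open>A matching edge that meets an equation or, by \<open>part_var\<close>, a
    variable of the path is one of the removed edges. So kept and new edges share no vertex.\<close>
  have part_eq: "\<exists>i<m. a = j (Suc i) \<and> w = v i" if "(a, w) \<in> N" "k \<le> m" "a = j k" for a w k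
  proof -
    have "k \<noteq> 0" using that uniq(3)[of a w] j0 by (cases k) auto
    then obtain i where "k = Suc i" by (cases k) auto
    then show ?thesis using that old[of i] uniq(1) by (metis Suc_le_eq)
  qed
  have part_var: "\<exists>i<m. a = j (Suc i) \<and> w = v i" if "(a, w) \<in> N" "k \<le> m" "w = v k" for a w k
  proof -
    have "k \<noteq> m" using that vm u(2) unfolding exposed_var_def by blast
    then show ?thesis using that old[of k] uniq(2) by (metis le_neq_implies_less)
  qed
  have "augment N ps \<subseteq> edges G" using aug_iff new(1) uniq(4) by auto
  moreover have "Domain (augment N ps) = {..<Suc r}"
  proof (intro set_eqI iffI)
    fix a assume "a \<in> Domain (augment N ps)"
    then obtain w where "(a, w) \<in> augment N ps" by blast
    then consider "(a, w) \<in> N" | i where "i \<le> m" "a = j i" using aug_iff by blast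
    then show "a \<in> {..<Suc r}"
    proof cases
      case 1
      then show ?thesis using uniq(3) by (simp add: less_SucI)
    next
      case 2
      then show ?thesis using old[of "i - 1"] uniq(3)[of a] j0 by (cases i) (auto simp: less_SucI)
    qed
  next
    fix a assume a: "a \<in> {..<Suc r}"
    show "a \<in> Domain (augment N ps)"
    proof (cases "\<exists>i\<le>m. a = j i")
      case True
      then show ?thesis using aug_iff by blast
    next
      case False
      then have "a < r" using a j0 by (metis lessThan_iff less_antisym zero_le)
      then obtain w where "(a, w) \<in> N" using M unfolding row_matching_def by blast
      moreover have "\<forall>i<m. (a, w) \<noteq> (j (Suc i), v i)" using False by (auto simp: Suc_le_eq)
      ultimately show ?thesis using aug_iff by blast
    qed
  qed
  moreover have sv: "w = w'" if "(a, w) \<in> augment N ps" "(a, w') \<in> augment N ps" for a w w'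
    using that uniq(1)[of a w w'] injj part_eq[of a w] part_eq[of a w'] unfolding aug_iff by blast
  moreover have svc: "a = a'" if "(a, w) \<in> augment N ps" "(a', w) \<in> augment N ps" for a a' w
    using that uniq(2)[of a w a'] injv part_var[of a w] part_var[of a' w] unfolding aug_iff by blast
  moreover have "single_valued (augment N ps)" "single_valued ((augment N ps)\<inverse>)"
    using sv svc by (simp_all add: single_valued_def)
  ultimately show ?thesis unfolding row_matching_def by blast
qed

text \<open>Augmenting produces a matching of all rows up to \<open>r\<close>, which excludes
  deficient sets. Without an augmenting path the reached set is one.\<close>

lemma augmenting_path_iff_not_deficient:
  assumes M: "row_matching (edges G) N r" and G: "Range (edges G) \<subseteq> var_vertices G"
    and fin: "finite (edges G)"
  shows "(\<exists>ps. augmenting_path G N r ps) \<longleftrightarrow> (\<nexists>S. deficient (edges G) r S)"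
proof
  assume "\<exists>ps. augmenting_path G N r ps"
  then obtain N' where "row_matching (edges G) N' (Suc r)"
    using row_matching_augment[OF M] by blast
  then have "card S \<le> card (edges G `` S)" if "S \<subseteq> {..r}" for S
    using that by (intro row_matching_card_le(2)[OF _ fin]) (auto simp: lessThan_Suc_atMost)
  then show "\<nexists>S. deficient (edges G) r S" unfolding deficient_def by (meson not_less)
next
  assume "\<nexists>S. deficient (edges G) r S"
  then show "\<exists>ps. augmenting_path G N r ps" using deficient_reached[OF M G] by blast
qed

lemma reached_eq_Inter_deficient:
  assumes "row_matching (edges G) N r" "Range (edges G) \<subseteq> var_vertices G"
    and "finite (edges G)" "\<nexists>ps. augmenting_path G N r ps"
  shows "reached G N r = \<Inter>{S. deficient (edges G) r S}"
  using deficient_reached[OF assms(1,2,4)] reached_subset_deficient[OF assms(1,3)] by blast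

section \<open>The Pantelides algorithm\<close>

lemma Range_incidence_graph:
  "Range (edges (incidence_graph es W adj)) \<subseteq> var_vertices (incidence_graph es W adj)"
  by (auto simp: incidence_graph_def)

lemma mem_dae_edges:
  "(j, v) \<in> edges (dae_match_graph U s) \<longleftrightarrow>
     j < length (eqs s) \<and> v \<in> highest_derivatives U (present s) \<and> v \<in> eqs s ! j"
  by (simp add: dae_match_graph_def incidence_graph_def)

lemma Range_dae_edges: "Range (edges (dae_match_graph U s)) \<subseteq> var_vertices (dae_match_graph U s)"
  unfolding dae_match_graph_def by (rule Range_incidence_graph)

lemma mem_highest_derivatives:
  "(c, p) \<in> highest_derivatives U V \<longleftrightarrow> (c, p) \<in> V \<and> c \<in> U \<and> (\<forall>q. (c, q) \<in> V \<longrightarrow> q \<le> p)"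
proof -
  have "(\<forall>s>0. (c, p + s) \<notin> V) \<longleftrightarrow> (\<forall>q. (c, q) \<in> V \<longrightarrow> q \<le> p)"
    by (metis add_diff_inverse_nat less_add_same_cancel1 not_less not_less_iff_gr_or_eq
        zero_less_diff)
  then show ?thesis by (auto simp: highest_derivatives_def)
qed

lemma mem_dae_deriv: "(c, p) \<in> dae_deriv E \<longleftrightarrow> (c, p) \<in> E \<or> (\<exists>q. p = Suc q \<and> (c, q) \<in> E)"
  by (auto simp: dae_deriv_def)

lemma finite_dae_deriv: "finite E \<Longrightarrow> finite (dae_deriv E)"
proof -
  assume "finite E"
  moreover have "dae_deriv E = E \<union> (\<lambda>(c, p). (c, Suc p)) ` E" by (force simp: dae_deriv_def)
  ultimately show ?thesis by simp
qed

lemma length_replace_eqs [simp]: "length (replace_eqs C f es) = length es"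
  by (simp add: replace_eqs_def)

lemma nth_replace_eqs [simp]:
  "j < length es \<Longrightarrow> replace_eqs C f es ! j = (if j \<in> C then f j (es ! j) else es ! j)"
  by (simp add: replace_eqs_def)

lemma mem_Union_set_conv_nth: "x \<in> \<Union>(set es) \<longleftrightarrow> (\<exists>j<length es. x \<in> es ! j)"
  by (metis Union_iff in_set_conv_nth)

lemma Union_subset_replace_eqs:
  assumes "\<And>j E. E \<subseteq> f j E"
  shows "\<Union>(set es) \<subseteq> \<Union>(set (replace_eqs C f es))"
proof
  fix x assume "x \<in> \<Union>(set es)"
  then obtain j where "j < length es" "x \<in> es ! j" unfolding mem_Union_set_conv_nth by blast
  then have "j < length (replace_eqs C f es)" "x \<in> replace_eqs C f es ! j"
    using assms by auto
  then show "x \<in> \<Union>(set (replace_eqs C f es))" unfolding mem_Union_set_conv_nth by blast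
qed

section \<open>The invariant of the Pantelides algorithm\<close>

definition pantelides_inv :: "'c set \<Rightarrow> ('c dvar, 'c dvar) state \<Rightarrow> bool" where
  "pantelides_inv U s \<longleftrightarrow>
     present s = \<Union>(set (eqs s)) \<and> finite (present s) \<and>
     row_matching (edges (dae_match_graph U s)) (matching s) (row s)"

lemma finite_dae_edges: "pantelides_inv U s \<Longrightarrow> finite (edges (dae_match_graph U s))"
proof -
  assume "pantelides_inv U s"
  moreover have "edges (dae_match_graph U s) \<subseteq> {..<length (eqs s)} \<times> present s"
    by (auto simp: mem_dae_edges mem_highest_derivatives)
  ultimately show ?thesis
    unfolding pantelides_inv_def by (meson finite_SigmaI finite_lessThan finite_subset)
qed

lemma pantelides_blocked_iff:
  assumes "pantelides_inv U s" "row s < length (eqs s)"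
  shows "blocked (dae_match_graph U) s \<longleftrightarrow> (\<exists>S. deficient (edges (dae_match_graph U s)) (row s) S)"
  using assms augmenting_path_iff_not_deficient[OF _ Range_dae_edges finite_dae_edges]
  unfolding blocked_def pantelides_inv_def by blast

lemma pantelides_blocked_set:
  assumes "pantelides_inv U s" "blocked (dae_match_graph U) s"
  shows "blocked_set (dae_match_graph U) s =
    \<Inter>{S. deficient (edges (dae_match_graph U s)) (row s) S}"
  using assms reached_eq_Inter_deficient[OF _ Range_dae_edges finite_dae_edges]
  unfolding blocked_set_def blocked_def pantelides_inv_def by blast

lemma pantelides_inv_start:
  "\<forall>E\<in>set es. finite E \<Longrightarrow> pantelides_inv U (dae_start es)"
  by (auto simp: pantelides_inv_def dae_start_def row_matching_def single_valued_def)

lemma dae_diff_stepD: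
  assumes "dae_diff_step U s s'"
  shows "blocked (dae_match_graph U) s" "row s' = row s" "row s < length (eqs s)"
    "eqs s' = replace_eqs (blocked_set (dae_match_graph U) s) (\<lambda>_. dae_deriv) (eqs s)"
    "present s' = present s \<union> \<Union>(set (eqs s'))"
    "matching s' = replace_edges (blocked_set (dae_match_graph U) s) (\<lambda>(c, p). (c, Suc p)) (matching s)"
  using assms unfolding dae_diff_step_def Let_def blocked_def by simp_all

lemma augment_stepD:
  assumes "augment_step graph s s'"
  obtains ps where "row s < length (eqs s)" "augmenting_path (graph s) (matching s) (row s) ps"
    "eqs s' = eqs s" "present s' = present s" "row s' = Suc (row s)"
    "matching s' = augment (matching s) ps"
  using assms unfolding augment_step_def by auto

lemma augment_step_not_blocked: "augment_step graph s s' \<Longrightarrow> \<not> blocked graph s"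
  unfolding augment_step_def blocked_def by blast

lemma pantelides_inv_augment:
  assumes inv: "pantelides_inv U s" and step: "augment_step (dae_match_graph U) s s'"
  shows "pantelides_inv U s'"
proof -
  from step obtain ps where aug: "augmenting_path (dae_match_graph U s) (matching s) (row s) ps"
    and eq: "eqs s' = eqs s" "present s' = present s" "row s' = Suc (row s)"
      "matching s' = augment (matching s) ps"
    by (rule augment_stepD)
  have graph: "dae_match_graph U s' = dae_match_graph U s"
    by (simp add: dae_match_graph_def eq)
  show ?thesis
    using inv row_matching_augment[OF _ aug] unfolding pantelides_inv_def graph eq by blast
qed

text \<open>Inside the blocked set a matched highest derivative moves up together with its equation.
  The danger lies outside it: a matched variable there could lose its place as highest derivative.
  Closure of the blocked set prevents this.\<close>

lemma pantelides_inv_diff: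
  assumes inv: "pantelides_inv U s" and step: "dae_diff_step U s s'"
  shows "pantelides_inv U s'"
proof -
  note D = dae_diff_stepD[OF step]
  define C where "C = blocked_set (dae_match_graph U) s"
  define N where "N = matching s"
  define V where "V = present s"
  have V: "V = \<Union>(set (eqs s))" "finite V"
    and M: "row_matching (edges (dae_match_graph U s)) N (row s)"
    using inv unfolding pantelides_inv_def V_def N_def by blast+
  note uniq = row_matching_unique[OF M]
  have len: "length (eqs s') = length (eqs s)" by (simp add: D(4))
  have nth: "eqs s' ! j = (if j \<in> C then dae_deriv (eqs s ! j) else eqs s ! j)"
    if "j < length (eqs s)" for j using that by (simp add: D(4) C_def)
  have closed: "\<exists>i\<in>C. (i, v) \<in> N" if "j \<in> C" "(j, v) \<in> edges (dae_match_graph U s)" for j v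
    using reached_closed[OF M Range_dae_edges _ _ that(2)] D(1) that(1)
    unfolding C_def blocked_set_def blocked_def N_def by blast
  have pres: "present s' = \<Union>(set (eqs s'))"
    unfolding D(5) using Union_subset_replace_eqs[of "\<lambda>_. dae_deriv" "eqs s" C] V(1)
    by (auto simp: D(4) C_def V_def dae_deriv_def)
  have V': "(c, p) \<in> present s' \<longleftrightarrow>
      (c, p) \<in> V \<or> (\<exists>j q. j \<in> C \<and> j < length (eqs s) \<and> p = Suc q \<and> (c, q) \<in> eqs s ! j)" for c p
  proof -
    have "(c, p) \<in> present s' \<longleftrightarrow> (\<exists>j<length (eqs s). (c, p) \<in> eqs s' ! j)"
      unfolding pres mem_Union_set_conv_nth len ..
    moreover have "(c, p) \<in> V \<longleftrightarrow> (\<exists>j<length (eqs s). (c, p) \<in> eqs s ! j)"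
      unfolding V(1) mem_Union_set_conv_nth ..
    ultimately show ?thesis using nth by (auto simp: mem_dae_deriv split: if_splits)
  qed
  have V'_imp: "(c, p) \<in> present s' \<Longrightarrow> (c, p) \<in> V \<or> (\<exists>q. p = Suc q \<and> (c, q) \<in> V)" for c p
    unfolding V' V(1) mem_Union_set_conv_nth by blast
  have N_edge: "j < length (eqs s)" "(c, p) \<in> eqs s ! j" "c \<in> U" "(c, q) \<in> V \<Longrightarrow> q \<le> p"
    if "(j, c, p) \<in> N" for j c p q
    using uniq(4)[OF that] by (simp_all add: mem_dae_edges mem_highest_derivatives V_def)
  have N': "(j, c, p) \<in> matching s' \<longleftrightarrow>
      (j \<notin> C \<and> (j, c, p) \<in> N) \<or> (j \<in> C \<and> (\<exists>q. p = Suc q \<and> (j, c, q) \<in> N))" for j c p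
    by (auto simp: D(6) C_def N_def replace_edges_def)
  have "finite (present s')"
  proof -
    have "present s' \<subseteq> dae_deriv V" using V'_imp by (auto simp: mem_dae_deriv)
    then show ?thesis using finite_dae_deriv[OF V(2)] by (rule finite_subset)
  qed
  moreover have "(j, c, p) \<in> edges (dae_match_graph U s')" if j: "(j, c, p) \<in> matching s'" for j c p
  proof (cases "j \<in> C")
    case True
    then obtain q where q: "p = Suc q" "(j, c, q) \<in> N" using j N' by blast
    note E = N_edge[OF q(2)]
    have mem: "(c, p) \<in> eqs s' ! j" using E(1,2) q(1) nth True by (simp add: mem_dae_deriv)
    then have "(c, p) \<in> present s'"
      using E(1) len unfolding pres mem_Union_set_conv_nth by auto
    moreover have "p' \<le> p" if "(c, p') \<in> present s'" for p'
      using V'_imp[OF that] E(4) q(1) by force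
    ultimately show ?thesis using mem E(1,3) len by (simp add: mem_dae_edges mem_highest_derivatives)
  next
    case False
    then have jN: "(j, c, p) \<in> N" using j N' by blast
    note E = N_edge[OF jN]
    have mem: "(c, p) \<in> eqs s' ! j" using E(1,2) nth False by simp
    then have "(c, p) \<in> present s'"
      using E(1) len unfolding pres mem_Union_set_conv_nth by auto
    \<comment> \<open>A new higher derivative of \<open>c\<close> can only arise from an equation of
      \<open>C\<close> that contains \<open>(c, p)\<close>. This makes \<open>(c, p)\<close> a
      neighbour of \<open>C\<close>, so its partner would lie in \<open>C\<close>, but its partner
      is \<open>j\<close>.\<close>
    moreover have "p' \<le> p" if p': "(c, p') \<in> present s'" for p'
    proof (rule ccontr)
      assume "\<not> p' \<le> p"
      then have "(c, p') \<notin> V" using E(4) by blast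
      then obtain i q where i: "i \<in> C" "i < length (eqs s)" "p' = Suc q" "(c, q) \<in> eqs s ! i"
        using V'[of c p'] p' by blast
      then have "(c, q) \<in> V" unfolding V(1) mem_Union_set_conv_nth by blast
      then have "q = p" using E(4)[of q] i(3) \<open>\<not> p' \<le> p\<close> by simp
      moreover have "(c, p) \<in> V" using E(1,2) unfolding V(1) mem_Union_set_conv_nth by blast
      ultimately have "(i, c, p) \<in> edges (dae_match_graph U s)"
        using i(2,4) E(3,4) by (simp add: mem_dae_edges mem_highest_derivatives V_def)
      then obtain i' where "i' \<in> C" "(i', c, p) \<in> N" using closed i(1) by blast
      then show False using uniq(2)[OF jN] False by blast
    qed
    ultimately show ?thesis using mem E(1,3) len by (simp add: mem_dae_edges mem_highest_derivatives)
  qed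
  then have "matching s' \<subseteq> edges (dae_match_graph U s')" by (metis subrelI surj_pair)
  moreover have "Domain (matching s') = {..<row s}"
  proof -
    have "j \<in> Domain (matching s') \<longleftrightarrow> j \<in> Domain N" for j
      by (cases "j \<in> C") (simp_all add: Domain_iff N' split_paired_Ex)
    then show ?thesis using M unfolding row_matching_def by blast
  qed
  moreover have "single_valued (matching s')"
  proof (rule single_valuedI)
    fix j v w assume "(j, v) \<in> matching s'" "(j, w) \<in> matching s'"
    moreover obtain c p where v: "v = (c, p)" by (cases v)
    moreover obtain c' p' where w: "w = (c', p')" by (cases w)
    ultimately have jv: "(j, c, p) \<in> matching s'" and jw: "(j, c', p') \<in> matching s'" by simp_all
    show "v = w"
    proof (cases "j \<in> C")
      case True
      then obtain q q' where "p = Suc q" "(j, c, q) \<in> N" "p' = Suc q'" "(j, c', q') \<in> N"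
        using jv jw by (auto simp: N')
      then show ?thesis using uniq(1)[of j "(c, q)" "(c', q')"] v w by simp
    next
      case False
      then have "(j, v) \<in> N" "(j, w) \<in> N" using jv jw by (simp_all add: N' v w)
      then show ?thesis by (rule uniq(1))
    qed
  qed
  moreover have "i = j" if ij: "(i, c, p) \<in> matching s'" "(j, c, p) \<in> matching s'" for i j c p
  proof -
    \<comment> \<open>An unmoved edge and a moved edge ending in the same variable would come from
      two matched derivatives of \<open>c\<close> of consecutive orders, of which the lower one is
      not highest.\<close>
    have mixed: False if "(a, c, p) \<in> N" "(b, c, q) \<in> N" "p = Suc q" for a b q
    proof -
      have "(c, p) \<in> V" using N_edge(1,2)[OF that(1)] unfolding V(1) mem_Union_set_conv_nth by blast
      then show False using N_edge(4)[OF that(2)] that(3) by fastforce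
    qed
    show ?thesis
    proof (cases "i \<in> C"; cases "j \<in> C")
      assume "i \<in> C" "j \<in> C"
      then obtain q where "(i, c, q) \<in> N" "(j, c, q) \<in> N" using ij by (auto simp: N')
      then show ?thesis by (rule uniq(2))
    next
      assume "i \<notin> C" "j \<notin> C"
      then show ?thesis using that by (intro uniq(2)) (simp_all add: N')
    next
      assume "i \<in> C" "j \<notin> C"
      then have "\<exists>q. p = Suc q \<and> (i, c, q) \<in> N" "(j, c, p) \<in> N" using that by (simp_all add: N')
      then show ?thesis using mixed by blast
    next
      assume "i \<notin> C" "j \<in> C"
      then have "\<exists>q. p = Suc q \<and> (j, c, q) \<in> N" "(i, c, p) \<in> N" using that by (simp_all add: N')
      then show ?thesis using mixed by blast
    qed
  qed
  then have "single_valued ((matching s')\<inverse>)" by (intro single_valuedI) auto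
  ultimately show ?thesis
    using pres unfolding pantelides_inv_def row_matching_def D(2) by blast
qed

lemma pantelides_inv_step: "pantelides_inv U s \<Longrightarrow> dae_step U s s' \<Longrightarrow> pantelides_inv U s'"
  unfolding dae_step_def using pantelides_inv_augment pantelides_inv_diff by blast

section \<open>Termination under Hall's condition for components\<close>

definition components :: "'c set \<Rightarrow> 'c dvar set list \<Rightarrow> nat set \<Rightarrow> 'c set" where
  "components U es S = {c \<in> U. \<exists>j\<in>S. \<exists>p. (c, p) \<in> es ! j}"

text \<open>Hall's condition after forgetting orders. \<open>dae_deriv\<close> adds only orders of
  components already in the equation, so the condition survives every step.\<close>

definition component_hall :: "'c set \<Rightarrow> 'c dvar set list \<Rightarrow> bool" where
  "component_hall U es \<longleftrightarrow> (\<forall>S\<subseteq>{..<length es}. card S \<le> card (components U es S))"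

lemma length_eqs_dae_step: "dae_step U s s' \<Longrightarrow> length (eqs s') = length (eqs s)"
  unfolding dae_step_def by (auto simp: dae_diff_stepD(4) elim: augment_stepD)

lemma component_hall_dae_step:
  assumes "dae_step U s s'" "component_hall U (eqs s)"
  shows "component_hall U (eqs s')"
proof -
  have "(\<exists>p. (c, p) \<in> eqs s' ! j) \<longleftrightarrow> (\<exists>p. (c, p) \<in> eqs s ! j)" if "j < length (eqs s)" for c j
    using assms(1) unfolding dae_step_def
  proof
    assume "augment_step (dae_match_graph U) s s'"
    then show ?thesis by (elim augment_stepD) simp
  next
    assume "dae_diff_step U s s'"
    from dae_diff_stepD(4)[OF this] show ?thesis using that by (auto simp: mem_dae_deriv)
  qed
  then have "components U (eqs s') S = components U (eqs s) S" if "S \<subseteq> {..<length (eqs s)}" for S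
    using that unfolding components_def by blast
  then show ?thesis
    using assms(2) length_eqs_dae_step[OF assms(1)] unfolding component_hall_def by simp
qed

text \<open>
  In an infinite sequence of differentiations the row equation belongs to the set \<open>A\<close> of
  equations that are left out only finitely often. The lag of all other equations becomes so large
  that eventually the highest derivatives of all components of \<open>A\<close> appear in no equation
  outside \<open>A\<close>. By Hall's condition, removing \<open>A\<close> from the blocked set then leaves a deficient set
  without the row, which contradicts the minimality of the blocked set.
\<close>

lemma no_infinite_differentiation:
  assumes inv0: "pantelides_inv U (g 0)" and hall: "component_hall U (eqs (g 0))"
    and step: "\<And>i. dae_diff_step U (g i) (g (Suc i))"
  shows False
proof -
  define C where "C i = blocked_set (dae_match_graph U) (g i)" for i
  define r where "r = row (g 0)"
  define es where "es = eqs (g 0)"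
  define L where "L = length es"
  \<comment> \<open>The number of times equation \<open>j\<close> has been differentiated before
    stage \<open>i\<close>.\<close>
  define k where "k i j = (\<Sum>i'<i. if j \<in> C i' then 1 else 0 :: nat)" for i j
  note D = dae_diff_stepD[OF step]
  have inv: "pantelides_inv U (g i)" for i
    using inv0 pantelides_inv_diff step by (induction i) blast+
  have row: "row (g i) = r" for i by (induction i) (simp_all add: r_def D(2))
  have len: "length (eqs (g i)) = L" for i by (induction i) (simp_all add: L_def es_def D(4))
  have pres: "present (g i) = \<Union>(set (eqs (g i)))" "finite (present (g i))"
    and M: "row_matching (edges (dae_match_graph U (g i))) (matching (g i)) r" for i
    using inv[of i] unfolding pantelides_inv_def row by blast+
  have rL: "r < L" using D(3)[of 0] by (simp add: row len)
  have C_reached: "C i = reached (dae_match_graph U (g i)) (matching (g i)) r" for i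
    by (simp add: C_def blocked_set_def row)
  have C_sub: "C i \<subseteq> {..r}" for i unfolding C_reached by (rule reached_subset[OF M])
  have r_C: "r \<in> C i" for i unfolding C_reached by (rule row_mem_reached)
  have k_Suc: "k (Suc i) j = k i j + (if j \<in> C i then 1 else 0)" for i j
    by (simp add: k_def)
  have mem_eqs: "(c, p) \<in> eqs (g i) ! j \<longleftrightarrow> (\<exists>q. (c, q) \<in> es ! j \<and> q \<le> p \<and> p \<le> q + k i j)"
    if "j < L" for i j c p
  proof (induction i arbitrary: p)
    case 0
    then show ?case by (auto simp: k_def es_def)
  next
    case (Suc i)
    have nth: "eqs (g (Suc i)) ! j = (if j \<in> C i then dae_deriv (eqs (g i) ! j) else eqs (g i) ! j)"
      using that by (simp add: D(4) C_def len)
    show ?case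
    proof (cases "j \<in> C i")
      case True
      have "(c, p) \<in> eqs (g (Suc i)) ! j \<longleftrightarrow>
          (\<exists>q. (c, q) \<in> es ! j \<and> q \<le> p \<and> p \<le> q + k i j) \<or>
          (\<exists>p'. p = Suc p' \<and> (\<exists>q. (c, q) \<in> es ! j \<and> q \<le> p' \<and> p' \<le> q + k i j))"
        using True nth Suc by (simp add: mem_dae_deriv)
      also have "\<dots> \<longleftrightarrow> (\<exists>q. (c, q) \<in> es ! j \<and> q \<le> p \<and> p \<le> q + k (Suc i) j)"
        using True by (cases p) (auto simp: k_Suc le_Suc_eq)
      finally show ?thesis .
    next
      case False
      then show ?thesis using nth Suc by (simp add: k_Suc)
    qed
  qed
  \<comment> \<open>Being finitely many, these equations share a stage \<open>T\<close> after which
    none of them is left out. Hence each of them is at most \<open>T\<close> differentiations behind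
    the stage.\<close>
  define A where "A = {j. j < L \<and> finite {i. j \<notin> C i}}"
  have A_L: "A \<subseteq> {..<L}" by (auto simp: A_def)
  have fA: "finite A" using finite_subset[OF A_L] by simp
  have r_A: "r \<in> A" using r_C rL by (simp add: A_def)
  have "finite (\<Union>j\<in>A. {i. j \<notin> C i})" using fA by (auto simp: A_def)
  then obtain T where T: "\<And>i j. j \<in> A \<Longrightarrow> T \<le> i \<Longrightarrow> j \<in> C i"
    unfolding finite_nat_set_iff_bounded by (metis (mono_tags, lifting) UN_I mem_Collect_eq not_less)
  have k_A: "i \<le> k i j + T" if "j \<in> A" for i j
  proof (induction i)
    case (Suc i)
    then show ?case using T[OF that, of i] by (cases "T \<le> i") (auto simp: k_Suc)
  qed simp
  obtain P where P: "\<And>c q j. j < L \<Longrightarrow> (c, q) \<in> es ! j \<Longrightarrow> q \<le> P"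
  proof -
    have "finite (snd ` present (g 0))" using pres(2) by simp
    then obtain P where "\<forall>q\<in>snd ` present (g 0). q \<le> P"
      unfolding finite_nat_set_iff_bounded_le by blast
    moreover have "q \<in> snd ` present (g 0)" if "j < L" "(c, q) \<in> es ! j" for c q j
    proof -
      have "(c, q) \<in> present (g 0)"
        using that unfolding pres(1) mem_Union_set_conv_nth len es_def by blast
      then show ?thesis by force
    qed
    ultimately have "j < L \<Longrightarrow> (c, q) \<in> es ! j \<Longrightarrow> q \<le> P" for c q j by blast
    then show ?thesis by (rule that)
  qed
  \<comment> \<open>The deficit \<open>i - k i j\<close> never decreases and grows by one at each of
    the infinitely many stages that leave out \<open>j\<close>.\<close>
  have lag: "\<exists>i0. \<forall>i\<ge>i0. k i j + B \<le> i" if "j < L" "j \<notin> A" for j B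
  proof (induction B)
    case 0
    have "k i j \<le> i" for i by (induction i) (simp_all add: k_def)
    then show ?case by simp
  next
    case (Suc B)
    then obtain i0 where i0: "\<And>i. i0 \<le> i \<Longrightarrow> k i j + B \<le> i" by blast
    have "infinite {i. j \<notin> C i}" using that by (simp add: A_def)
    then obtain i1 where i1: "i0 \<le> i1" "j \<notin> C i1"
      unfolding finite_nat_set_iff_bounded by (metis mem_Collect_eq not_less)
    have "k i j + Suc B \<le> i" if "Suc i1 \<le> i" for i
      using that
    proof (induction i rule: dec_induct)
      case base
      then show ?case using i1 i0[of i1] by (simp add: k_Suc)
    next
      case (step i)
      then show ?case by (simp add: k_Suc)
    qed
    then show ?case by blast
  qed
  \<comment> \<open>A component of an equation in \<open>A\<close> has an order of at least
    \<open>i - T\<close> at stage \<open>i\<close>. Outside \<open>A\<close>, orders are at most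
    \<open>P + k i j\<close>, so a lag of \<open>T + P + 1\<close> keeps them strictly below
    \<open>i - T\<close>.\<close>
  define B where "B = Suc (T + P)"
  obtain i0 where i0: "\<And>i j. j < L \<Longrightarrow> j \<notin> A \<Longrightarrow> i0 j \<le> i \<Longrightarrow> k i j + B \<le> i"
    using lag[of _ B] by metis
  \<comment> \<open>The sum dominates every threshold \<open>i0 j\<close>, and the summand
    \<open>T\<close> ensures that all of \<open>A\<close> is blocked at this stage.\<close>
  define i where "i = T + (\<Sum>j<L. i0 j)"
  have k_not_A: "k i j + B \<le> i" if "j < L" "j \<notin> A" for j
    using that member_le_sum[of j "{..<L}" i0] by (intro i0) (simp_all add: i_def)
  define E where "E = edges (dae_match_graph U (g i))"
  have fE: "finite E" unfolding E_def by (rule finite_dae_edges[OF inv])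
  have tight: "j' \<in> A"
    if j: "j \<in> A" "(c, q) \<in> es ! j" and j': "j' < L" "(c, p) \<in> eqs (g i) ! j'"
      and high: "(c, p) \<in> highest_derivatives U (present (g i))" for j j' c p q
  proof (rule ccontr)
    assume "j' \<notin> A"
    have "j < L" using j(1) A_L by blast
    then have "(c, q + k i j) \<in> eqs (g i) ! j" using j(2) mem_eqs by auto
    then have "(c, q + k i j) \<in> present (g i)"
      using \<open>j < L\<close> unfolding pres(1) mem_Union_set_conv_nth len by blast
    then have "q + k i j \<le> p" using high by (simp add: mem_highest_derivatives)
    moreover obtain q' where "(c, q') \<in> es ! j'" "p \<le> q' + k i j'" using j' mem_eqs by blast
    ultimately show False
      using k_A[OF j(1), of i] k_not_A[OF j'(1) \<open>j' \<notin> A\<close>] P[OF j'(1)] unfolding B_def by fastforce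
  qed
  \<comment> \<open>Each unknown component of \<open>A\<close> has a highest derivative, which by
    \<open>tight\<close> appears in an equation of \<open>A\<close>. Hall's condition for components
    thus yields Hall's inequality for \<open>A\<close> in the graph of highest derivatives.\<close>
  have "components U es A \<subseteq> fst ` (E `` A)"
  proof
    fix c assume "c \<in> components U es A"
    then obtain j q where j: "c \<in> U" "j \<in> A" "(c, q) \<in> es ! j" unfolding components_def by blast
    then have "j < L" using A_L by blast
    then have "(c, q) \<in> eqs (g i) ! j" using j(3) mem_eqs by auto
    then have "(c, q) \<in> present (g i)"
      using \<open>j < L\<close> unfolding pres(1) mem_Union_set_conv_nth len by blast
    moreover have "finite {p. (c, p) \<in> present (g i)}"
      using finite_vimageI[OF pres(2), of "Pair c"] by (simp add: vimage_def inj_on_def)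
    ultimately obtain p where p: "(c, p) \<in> present (g i)" "\<And>p'. (c, p') \<in> present (g i) \<Longrightarrow> p' \<le> p"
      using Max_in[of "{p. (c, p) \<in> present (g i)}"] Max_ge[of "{p. (c, p) \<in> present (g i)}"]
      by blast
    then obtain j' where j': "j' < L" "(c, p) \<in> eqs (g i) ! j'"
      unfolding pres(1) mem_Union_set_conv_nth len by blast
    moreover have high: "(c, p) \<in> highest_derivatives U (present (g i))"
      using p j(1) by (simp add: mem_highest_derivatives)
    moreover have "j' \<in> A" using tight[OF j(2,3) j' high] .
    ultimately have "(c, p) \<in> E `` A" unfolding E_def by (auto simp: mem_dae_edges len)
    then show "c \<in> fst ` (E `` A)" by force
  qed
  then have "card (components U es A) \<le> card (fst ` (E `` A))"
    using finite_Image[OF fE] by (intro card_mono) auto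
  also have "\<dots> \<le> card (E `` A)" using finite_Image[OF fE] by (rule card_image_le)
  finally have card_A: "card A \<le> card (E `` A)"
    using hall A_L unfolding component_hall_def es_def[symmetric] L_def by (meson le_trans)
  have A_C: "A \<subseteq> C i" using T[of _ i] by (auto simp: i_def)
  have disj: "E `` A \<inter> E `` (C i - A) = {}"
  proof (rule equals0I, elim IntE ImageE)
    fix v j j' assume v: "(j, v) \<in> E" "j \<in> A" "(j', v) \<in> E" "j' \<in> C i - A"
    obtain c p where cp: "v = (c, p)" by (cases v)
    have "j < L" using v(2) A_L by blast
    then obtain q where "(c, q) \<in> es ! j"
      using v(1) mem_eqs unfolding E_def cp mem_dae_edges by blast
    then have "j' \<in> A" using tight[OF v(2)] v(3) unfolding E_def cp mem_dae_edges len by blast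
    then show False using v(4) by blast
  qed
  have fC: "finite (C i)" using finite_subset[OF C_sub] by simp
  have "E `` C i = E `` A \<union> E `` (C i - A)" using A_C by blast
  then have "card (E `` C i) = card (E `` A) + card (E `` (C i - A))"
    using card_Un_disjoint[OF _ _ disj] finite_Image[OF fE] by simp
  moreover have "card (E `` C i) < card (C i)"
    using deficient_reached[OF M Range_dae_edges] D(1)[of i]
    unfolding C_reached deficient_def blocked_def row E_def by blast
  moreover have "card (C i - A) = card (C i) - card A" using card_Diff_subset[OF fA A_C] .
  moreover have "card A \<le> card (C i)" using card_mono[OF fC A_C] .
  ultimately have "card (E `` (C i - A)) < card (C i - A)" using card_A by linarith
  then have "deficient E r (C i - A)" using C_sub by (auto simp: deficient_def)
  then have "C i \<subseteq> C i - A"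
    using reached_subset_deficient[OF M fE[unfolded E_def]] unfolding C_reached E_def by blast
  then show False using r_A r_C by blast
qed

text \<open>The row never decreases and stays bounded in an infinite run. From a state where it is
  largest only differentiations follow, and that state still satisfies the invariant and Hall's
  condition.\<close>

lemma pantelides_terminates:
  assumes "\<forall>E\<in>set es. finite E" and hall: "component_hall U es"
  shows "dae_terminates U es"
  unfolding dae_terminates_def terminates_def
proof (intro notI, elim exE conjE)
  fix f assume f0: "f 0 = dae_start es" and step: "\<forall>i. dae_step U (f i) (f (Suc i))"
  have inv: "pantelides_inv U (f i) \<and> component_hall U (eqs (f i)) \<and> length (eqs (f i)) = length es"
    for i
  proof (induction i)
    case 0
    then show ?case using pantelides_inv_start[OF assms(1)] hall by (simp add: f0 dae_start_def)
  next
    case (Suc i)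
    then show ?case
      using step pantelides_inv_step component_hall_dae_step length_eqs_dae_step by metis
  qed
  have row_step: "dae_diff_step U (f i) (f (Suc i)) \<and> row (f (Suc i)) = row (f i) \<or>
      row (f (Suc i)) = Suc (row (f i))" for i
    using step dae_diff_stepD(2) unfolding dae_step_def by (metis augment_stepD)
  have bound: "row (f i) < length es" for i
    using step inv[of i] dae_diff_stepD(3) unfolding dae_step_def by (metis augment_stepD)
  then obtain T where T: "\<And>i. row (f i) \<le> row (f T)"
    using ex_has_greatest_nat[of "\<lambda>_. True" 0 "\<lambda>i. row (f i)" "length es"] by auto
  have mono: "row (f (T + i)) = row (f T)" for i
  proof (induction i)
    case (Suc i)
    then show ?case using row_step[of "T + i"] T[of "Suc (T + i)"] by auto
  qed simp
  have "dae_diff_step U (f (T + i)) (f (Suc (T + i)))" for i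
    using row_step[of "T + i"] mono[of i] mono[of "Suc i"] by auto
  then show False
    using no_infinite_differentiation[of U "\<lambda>i. f (T + i)"] inv[of T] by simp
qed


section \<open>No equation is shifted\<close>

lemma mem_shift_edges:
  "(j, v) \<in> edges (shift_graph s) \<longleftrightarrow>
     j < length (eqs s) \<and> v \<in> highest_shifts (present s) \<and> in_class (eqs s ! j) v"
  by (simp add: shift_graph_def incidence_graph_def)

lemma is_ddaeD:
  assumes "is_ddae n F" "(c, k, p) \<in> \<Union>(set F)"
  shows "(\<exists>i<n. c = X i) \<and> (k = 0 \<and> p \<le> 1 \<or> k = -1 \<and> p = 0)"
  using assms unfolding is_ddae_def by fastforce

lemma is_ddae_finite:
  assumes "is_ddae n F"
  shows "finite (\<Union>(set F))"
proof -
  have "\<Union>(set F) \<subseteq> (\<Union>i<n. {(X i, 0, 0), (X i, 0, 1), (X i, -1, 0)})"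
    using assms unfolding is_ddae_def by blast
  then show ?thesis by (rule finite_subset) simp
qed

text \<open>In a DDAE of this form \<open>Theta_bar\<close> consists of all appearing variables with
  shift 0, and \<open>R_equal\<close> classes correspond to components. Later uses need only this
  inequality.\<close>

lemma structurally_nonsingular_card_le:
  assumes ddae: "is_ddae n F"
    and nonsing: "structurally_nonsingular F (Theta_bar n F) (R_equal (Theta_bar n F))"
    and S: "S \<subseteq> {..<length F}"
  shows "card S \<le> card {c. \<exists>j\<in>S. \<exists>p. (c, 0, p) \<in> F ! j}"
proof -
  define A where "A = {v \<in> Theta_bar n F. \<exists>j\<in>S. v \<in> F ! j}"
  define R where "R = R_equal (Theta_bar n F) \<inter> A \<times> A"
  have Theta: "Theta_bar n F = {(c, k, p). (c, k, p) \<in> \<Union>(set F) \<and> k = 0}" (is "_ = ?B")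
  proof
    show "Theta_bar n F \<subseteq> ?B" by (auto simp: Theta_bar_def)
    show "?B \<subseteq> Theta_bar n F"
    proof
      fix v assume "v \<in> ?B"
      then obtain c p where v: "v = (c, 0, p)" "(c, 0, p) \<in> \<Union>(set F)" by blast
      then have "v \<in> (\<Union>i<n. {(X i, 0, 0), (X i, 0, 1)})"
        using is_ddaeD[OF ddae v(2)] by (auto simp: le_Suc_eq)
      then show "v \<in> Theta_bar n F" using v unfolding Theta_bar_def by blast
    qed
  qed
  have A: "A = {(c, k, p). k = 0 \<and> (\<exists>j\<in>S. (c, k, p) \<in> F ! j)}"
    using S unfolding A_def Theta mem_Union_set_conv_nth by auto
  have "finite A"
    using is_ddae_finite[OF ddae] unfolding A_def Theta by (elim rev_finite_subset) auto
  \<comment> \<open>The classes are the fibres of \<open>fst\<close> over the components that occur,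
    hence no more numerous than these.\<close>
  have "A // R = (\<lambda>c. {v \<in> A. fst v = c}) ` fst ` A"
  proof -
    have "R `` {x} = {v \<in> A. fst v = fst x}" if "x \<in> A" for x
      using that by (auto simp: R_def R_equal_def A_def)
    then show ?thesis unfolding quotient_def by (auto simp: image_iff)
  qed
  then have "card (A // R) \<le> card (fst ` A)" using \<open>finite A\<close> by (simp add: card_image_le)
  moreover have "card S \<le> card (A // R)"
    using nonsing S
    unfolding structurally_nonsingular_def singular_subset_def Let_def A_def R_def
    by (meson not_less)
  moreover have "fst ` A = {c. \<exists>j\<in>S. \<exists>p. (c, 0, p) \<in> F ! j}" unfolding A by force
  ultimately show ?thesis by simp
qed

definition shifting_inv :: "var set list \<Rightarrow> (var, shift_class) state \<Rightarrow> bool" where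
  "shifting_inv F s \<longleftrightarrow> eqs s = F \<and> present s = \<Union>(set F) \<and>
     row_matching (edges (shift_graph s)) (matching s) (row s)"

context
  fixes n :: nat and F :: "var set list"
  assumes ddae: "is_ddae n F"
    and nonsing: "structurally_nonsingular F (Theta_bar n F) (R_equal (Theta_bar n F))"
begin

text \<open>No shift exceeds 0, so a present class with shift 0 is automatically highest. Classes
  with shift -1 are excluded by \<open>0 \<le> k\<close>.\<close>

lemma shift_edges_eq:
  assumes "shifting_inv F s"
  shows "edges (shift_graph s) = {(j, c, k). j < length F \<and> k = 0 \<and> (\<exists>p. (c, 0, p) \<in> F ! j)}"
proof -
  have high: "(c, k) \<in> highest_shifts (\<Union>(set F)) \<longleftrightarrow> k = 0"
    if "j < length F" "in_class (F ! j) (c, k)" for j c k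
  proof -
    have mem: "in_class (\<Union>(set F)) (c, k)"
      using that unfolding in_class_def prod.case mem_Union_set_conv_nth by blast
    have "k' \<le> 0" if "in_class (\<Union>(set F)) (c, k')" for k'
      using that is_ddaeD[OF ddae] unfolding in_class_def by fastforce
    then show ?thesis using mem unfolding highest_shifts_def by fastforce
  qed
  have eq: "eqs s = F" "present s = \<Union>(set F)"
    using assms unfolding shifting_inv_def by blast+
  have "in_class (F ! j) (c, k) \<longleftrightarrow> (\<exists>p. (c, k, p) \<in> F ! j)" for j c k
    by (simp add: in_class_def)
  then have "(j, c, k) \<in> edges (shift_graph s) \<longleftrightarrow> j < length F \<and> k = 0 \<and> (\<exists>p. (c, 0, p) \<in> F ! j)"
    for j c k
    unfolding mem_shift_edges eq using high by metis
  then show ?thesis by auto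
qed

lemma shifting_not_blocked:
  assumes inv: "shifting_inv F s"
  shows "\<not> blocked shift_graph s"
proof
  assume blocked: "blocked shift_graph s"
  let ?E = "edges (shift_graph s)"
  have M: "row_matching ?E (matching s) (row s)" and row: "row s < length F"
    using inv blocked by (simp_all add: shifting_inv_def blocked_def)
  note E = shift_edges_eq[OF inv]
  have "?E \<subseteq> {..<length F} \<times> (\<lambda>(c, k, p). (c, k)) ` \<Union>(set F)"
  proof
    fix x assume "x \<in> ?E"
    then obtain j c p where x: "x = (j, c, 0)" "j < length F" "(c, 0, p) \<in> F ! j"
      unfolding E by blast
    then have "(c, 0, p) \<in> \<Union>(set F)" unfolding mem_Union_set_conv_nth by blast
    then show "x \<in> {..<length F} \<times> (\<lambda>(c, k, p). (c, k)) ` \<Union>(set F)"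
      using x by force
  qed
  then have fin: "finite ?E"
    using is_ddae_finite[OF ddae] by (elim finite_subset) (intro finite_SigmaI finite_imageI; simp)
  have "Range ?E \<subseteq> var_vertices (shift_graph s)"
    unfolding shift_graph_def by (rule Range_incidence_graph)
  then obtain S where S: "S \<subseteq> {..row s}" "card (?E `` S) < card S"
    using augmenting_path_iff_not_deficient[OF M _ fin] blocked
    unfolding blocked_def deficient_def by blast
  have SF: "S \<subseteq> {..<length F}" using S(1) row by auto
  then have "?E `` S = (\<lambda>c. (c, 0)) ` {c. \<exists>j\<in>S. \<exists>p. (c, 0, p) \<in> F ! j}"
    unfolding E by auto
  then have "card (?E `` S) = card {c. \<exists>j\<in>S. \<exists>p. (c, 0, p) \<in> F ! j}"
    by (simp add: card_image inj_on_def)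
  then show False using S(2) structurally_nonsingular_card_le[OF ddae nonsing SF] by simp
qed

lemma shifting_inv_start: "shifting_inv F (ddae_start F)"
  by (simp add: shifting_inv_def ddae_start_def row_matching_def single_valued_def)

lemma shifting_inv_step:
  assumes inv: "shifting_inv F s" and step: "shifting_step s s'"
  shows "shifting_inv F s' \<and> row s < length F \<and> row s' = Suc (row s)"
proof -
  have "augment_step shift_graph s s'"
    using step shifting_not_blocked[OF inv] unfolding shifting_step_def shift_eqs_step_def by blast
  then obtain ps where row: "row s < length (eqs s)"
    and aug: "augmenting_path (shift_graph s) (matching s) (row s) ps"
    and eq: "eqs s' = eqs s" "present s' = present s" "row s' = Suc (row s)"
      "matching s' = augment (matching s) ps"
    by (rule augment_stepD)
  have graph: "shift_graph s' = shift_graph s" by (simp add: shift_graph_def eq)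
  show ?thesis
    using inv row row_matching_augment[OF _ aug] unfolding shifting_inv_def graph eq by simp
qed

lemma shifting_inv_run: "shifting_step\<^sup>*\<^sup>* (ddae_start F) s \<Longrightarrow> shifting_inv F s"
proof (induction rule: rtranclp_induct)
  case base
  show ?case by (rule shifting_inv_start)
next
  case (step y z)
  then show ?case using shifting_inv_step by blast
qed

lemma no_equation_shifted: "no_equation_shifted F"
  using shifting_inv_run shifting_not_blocked
  unfolding no_equation_shifted_def shift_eqs_step_def by blast

text \<open>Every step is an augmentation, so the row counts the steps.\<close>

lemma shifting_terminates: "terminates shifting_step (ddae_start F)"
  unfolding terminates_def
proof (intro notI, elim exE conjE)
  fix f assume f0: "f 0 = ddae_start F" and step: "\<forall>i. shifting_step (f i) (f (Suc i))"
  have inv: "shifting_inv F (f i) \<and> row (f i) = i" for i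
  proof (induction i)
    case 0
    then show ?case using shifting_inv_start by (simp add: f0 ddae_start_def)
  next
    case (Suc i)
    then show ?case using shifting_inv_step step by metis
  qed
  have "row (f (length F)) < length F" using shifting_inv_step inv step by blast
  then show False using inv by simp
qed


section \<open>Comparison of the two runs\<close>

lemma top_order_le_1: "top_order F i \<le> 1"
proof -
  have sub: "{p. \<exists>k\<ge>0. \<exists>E\<in>set F. (X i, k, p) \<in> E} \<subseteq> {..1}"
  proof
    fix p assume "p \<in> {p. \<exists>k\<ge>0. \<exists>E\<in>set F. (X i, k, p) \<in> E}"
    then obtain k where "(X i, k, p) \<in> \<Union>(set F)" by blast
    from is_ddaeD[OF ddae this] show "p \<in> {..1}" by auto
  qed
  then show ?thesis
    using finite_subset[OF sub] unfolding top_order_def by (subst Max_le_iff) auto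
qed

lemma trimmed_linearization_trivial:
  "trimmed_linearization n (F, \<Union>(set F)) = (F, \<Union>(set F))"
proof -
  have "lin_var F v = v" for v
    using top_order_le_1 not_less_eq_eq unfolding lin_var_def Let_def
    by (cases v) (auto split: comp.split simp: numeral_2_eq_2)
  then have "lin_var F = id" by (simp add: fun_eq_iff)
  moreover have "lin_eqs F i = []" for i
    using top_order_le_1[of i] by (simp add: lin_eqs_def)
  then have "concat (map (lin_eqs F) [0..<n]) = []" by simp
  ultimately show ?thesis by (simp add: trimmed_linearization_def)
qed

text \<open>Forming classes commutes with unions, so the auxiliary state is a regular start of the
  Pantelides algorithm and the general termination result applies to it.\<close>

lemma after_linearization_eq:
  assumes "yields shifting_step (ddae_start F) s"
  shows "after_linearization n s = ((F, \<Union>(set F)), dae_start (map order_classes F))"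
proof -
  have "eqs s = F" "present s = \<Union>(set F)"
    using assms shifting_inv_run unfolding yields_def shifting_inv_def by blast+
  moreover have "order_classes (\<Union>(set F)) = \<Union>(order_classes ` set F)"
    unfolding order_classes_def by blast
  ultimately show ?thesis
    by (simp add: after_linearization_def trimmed_linearization_trivial diff_start_def dae_start_def)
qed

end

section \<open>The differentiation step as a run of the Pantelides algorithm\<close>

lemma differentiation_step_imp_dae_step:
  "differentiation_step T T' \<Longrightarrow> dae_step UNIV (snd T) (snd T')"
  by (auto simp: differentiation_step_def dae_step_def split: prod.splits)

lemma terminates_differentiation_step:
  assumes "dae_terminates UNIV es"
  shows "terminates differentiation_step (D, dae_start es)"
  unfolding terminates_def
proof (intro notI, elim exE conjE)
  fix f assume f: "f 0 = (D, dae_start es)" "\<forall>i. differentiation_step (f i) (f (Suc i))"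
  have "snd (f 0) = dae_start es" using f(1) by simp
  moreover have "\<forall>i. dae_step UNIV (snd (f i)) (snd (f (Suc i)))"
    using f(2) differentiation_step_imp_dae_step by blast
  ultimately show False
    using assms unfolding dae_terminates_def terminates_def by (auto dest!: spec[of _ "\<lambda>i. snd (f i)"])
qed

section \<open>Renaming delayed variables as parameters\<close>

definition param_var :: "var \<Rightarrow> symbol dvar" where
  "param_var = (\<lambda>(c, k, p). (if k = -1 then Parameter c else Unknown c, p))"

lemma replace_delayed_eq: "replace_delayed F = map ((`) param_var) F"
  by (simp add: replace_delayed_def param_var_def)

text \<open>Renaming acts on component and shift, differentiation on the order. This and
  \<open>order_classes_deriv\<close> let the actual system, its classes and its renamed form be
  differentiated in parallel.\<close>

lemma param_var_deriv: "param_var ` deriv E = dae_deriv (param_var ` E)"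
proof -
  have "deriv E = E \<union> (\<lambda>(c, k, p). (c, k, Suc p)) ` E" by (force simp: deriv_def)
  moreover have "dae_deriv A = A \<union> (\<lambda>(c, p). (c, Suc p)) ` A" for A :: "symbol dvar set"
    by (force simp: dae_deriv_def)
  moreover have "param_var \<circ> (\<lambda>(c, k, p). (c, k, Suc p)) = (\<lambda>(c, p). (c, Suc p)) \<circ> param_var"
    by (auto simp: param_var_def)
  ultimately show ?thesis by (simp add: image_Un image_comp)
qed

lemma order_classes_deriv: "order_classes (deriv E) = dae_deriv (order_classes E)"
  by (auto simp: order_classes_def deriv_def dae_deriv_def)

text \<open>\<open>param_var\<close> forgets the shift unless it is -1, and
  \<open>order_classes\<close> forgets all nonnegative shifts. On these sets neither identifies
  distinct variables.\<close>

definition only_delayed_or_present :: "var set \<Rightarrow> bool" where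
  "only_delayed_or_present V \<longleftrightarrow> (\<forall>c k p. (c, k, p) \<in> V \<longrightarrow> k = -1 \<or> k = 0)"

lemma only_delayed_or_presentD:
  "only_delayed_or_present V \<Longrightarrow> (c, k, p) \<in> V \<Longrightarrow> k = -1 \<or> k = 0"
  unfolding only_delayed_or_present_def by blast

lemma inj_on_param_var:
  assumes "only_delayed_or_present V"
  shows "inj_on param_var V"
proof (rule inj_onI)
  fix u v assume uv: "u \<in> V" "v \<in> V" "param_var u = param_var v"
  obtain c k p where u: "u = (c, k, p)" by (cases u)
  obtain c' k' p' where v: "v = (c', k', p')" by (cases v)
  show "u = v"
    using uv(3) only_delayed_or_presentD[OF assms uv(1)[unfolded u]]
      only_delayed_or_presentD[OF assms uv(2)[unfolded v]]
    unfolding u v by (auto simp: param_var_def split: if_splits)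
qed

lemma is_unknown_param_var:
  "only_delayed_or_present V \<Longrightarrow> v \<in> V \<Longrightarrow> is_unknown (param_var v) \<longleftrightarrow> is_undelayed v"
  unfolding is_unknown_def param_var_def is_undelayed_def only_delayed_or_present_def by force

lemma mem_order_classes:
  "only_delayed_or_present E \<Longrightarrow> (c, p) \<in> order_classes E \<longleftrightarrow> (c, 0, p) \<in> E"
  unfolding order_classes_def only_delayed_or_present_def by force

lemma Unknown_mem_param_var:
  assumes "only_delayed_or_present E"
  shows "(Unknown c, p) \<in> param_var ` E \<longleftrightarrow> (c, 0, p) \<in> E"
proof
  assume "(Unknown c, p) \<in> param_var ` E"
  then obtain c' k p' where E: "(c', k, p') \<in> E" and "(Unknown c, p) = param_var (c', k, p')" by auto
  then have "k \<noteq> -1" "c' = c" "p' = p" by (auto simp: param_var_def split: if_splits)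
  then show "(c, 0, p) \<in> E" using only_delayed_or_presentD[OF assms E] E by simp
next
  assume "(c, 0, p) \<in> E"
  then show "(Unknown c, p) \<in> param_var ` E" by (rule rev_image_eqI) (simp add: param_var_def)
qed

section \<open>Simultaneous runs\<close>

text \<open>Both equation lists are images of the same system \<open>D\<close>. The matchings of
  \<open>a\<close> and \<open>s\<close> satisfy their own invariants but are not related to each
  other.\<close>

definition in_step ::
  "system \<Rightarrow> (comp dvar, comp dvar) state \<Rightarrow> (symbol dvar, symbol dvar) state \<Rightarrow> bool" where
  "in_step D a s \<longleftrightarrow>
     pantelides_inv UNIV a \<and> pantelides_inv (range Unknown) s \<and> row a = row s \<and>
     eqs a = map order_classes (fst D) \<and> eqs s = map ((`) param_var) (fst D) \<and>
     snd D = \<Union>(set (fst D)) \<and> only_delayed_or_present (snd D)"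

text \<open>Membership of \<open>(c, p)\<close> in a class set and of \<open>(Unknown c, p)\<close>
  in a renamed set both mean membership of \<open>(c, 0, p)\<close>, so highest derivatives
  correspond too.\<close>

lemma in_step_edges:
  assumes "in_step D a s"
  shows "edges (dae_match_graph (range Unknown) s) =
    (\<lambda>(j, c, p). (j, Unknown c, p)) ` edges (dae_match_graph UNIV a)" (is "?E = ?h ` ?A")
proof -
  obtain es V where D: "D = (es, V)" by (cases D)
  have eqs: "eqs a = map order_classes es" "eqs s = map ((`) param_var) es"
    and V: "V = \<Union>(set es)" "only_delayed_or_present V"
    and pres: "present a = \<Union>(set (eqs a))" "present s = \<Union>(set (eqs s))"
    using assms unfolding in_step_def pantelides_inv_def D by auto
  have es: "only_delayed_or_present (es ! j)" if "j < length es" for j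
    using V that unfolding only_delayed_or_present_def by (meson mem_Union_set_conv_nth)
  have "order_classes V = \<Union>(order_classes ` set es)" "param_var ` V = \<Union>((`) param_var ` set es)"
    unfolding V(1) order_classes_def by blast+
  then have pres': "present a = order_classes V" "present s = param_var ` V"
    using pres eqs by simp_all
  have "(j, Unknown c, p) \<in> ?E \<longleftrightarrow> (j, c, p) \<in> ?A" for j c p
    using es V(2) by (auto simp: mem_dae_edges mem_highest_derivatives pres' eqs
        mem_order_classes Unknown_mem_param_var)
  moreover have "\<exists>c p. v = (Unknown c, p)" if "(j, v) \<in> ?E" for j v
    using that by (cases v) (auto simp: mem_dae_edges mem_highest_derivatives)
  ultimately show ?thesis by (force simp: image_iff)
qed

lemma in_step_deficient:
  assumes "in_step D a s"
  shows "deficient (edges (dae_match_graph (range Unknown) s)) r S \<longleftrightarrow>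
    deficient (edges (dae_match_graph UNIV a)) r S"
proof -
  have "edges (dae_match_graph (range Unknown) s) `` S =
      (\<lambda>(c, p). (Unknown c, p)) ` (edges (dae_match_graph UNIV a) `` S)"
    unfolding in_step_edges[OF assms] by force
  moreover have "card ((\<lambda>(c, p). (Unknown c, p)) ` B) = card B" for B :: "comp dvar set"
    by (intro card_image) (auto simp: inj_on_def)
  ultimately have "card (edges (dae_match_graph (range Unknown) s) `` S) =
      card (edges (dae_match_graph UNIV a) `` S)"
    by simp
  then show ?thesis by (simp add: deficient_def)
qed

lemma in_step_row: "in_step D a s \<Longrightarrow> row a = row s \<and> length (eqs a) = length (eqs s)"
  by (simp add: in_step_def)

lemma in_step_blocked:
  assumes "in_step D a s"
  shows "blocked (dae_match_graph UNIV) a \<longleftrightarrow> blocked (dae_match_graph (range Unknown)) s"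
proof (cases "row a < length (eqs a)")
  case True
  then show ?thesis
    using assms in_step_row[OF assms] in_step_deficient[OF assms]
      pantelides_blocked_iff[of UNIV a] pantelides_blocked_iff[of "range Unknown" s]
    unfolding in_step_def by simp
next
  case False
  then show ?thesis using in_step_row[OF assms] by (simp add: blocked_def)
qed

lemma in_step_blocked_set:
  assumes "in_step D a s" "blocked (dae_match_graph UNIV) a"
  shows "blocked_set (dae_match_graph UNIV) a = blocked_set (dae_match_graph (range Unknown)) s"
  using assms in_step_blocked[OF assms(1)] in_step_deficient[OF assms(1)]
    pantelides_blocked_set[of UNIV a] pantelides_blocked_set[of "range Unknown" s]
  unfolding in_step_def by simp

lemma replace_eqs_map:
  assumes "\<And>E. h (f E) = g (h E)"
  shows "replace_eqs C (\<lambda>_. g) (map h es) = map h (replace_eqs C (\<lambda>_. f) es)"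
  using assms by (intro nth_equalityI) auto

lemma in_step_diff_system:
  assumes "V = \<Union>(set es)" "only_delayed_or_present V"
  shows "snd (diff_system C (es, V)) = \<Union>(set (fst (diff_system C (es, V))))"
    "only_delayed_or_present (snd (diff_system C (es, V)))"
proof -
  let ?es = "replace_eqs C (\<lambda>_. deriv) es"
  have sub: "V \<subseteq> \<Union>(set ?es)"
    unfolding assms(1) by (rule Union_subset_replace_eqs) (simp add: deriv_def)
  then show eq: "snd (diff_system C (es, V)) = \<Union>(set (fst (diff_system C (es, V))))"
    by (auto simp: diff_system_def Let_def)
  have "k = -1 \<or> k = 0" if "(c, k, p) \<in> \<Union>(set ?es)" for c k p
  proof -
    obtain j where j: "j < length es" "(c, k, p) \<in> ?es ! j"
      using \<open>(c, k, p) \<in> \<Union>(set ?es)\<close> unfolding mem_Union_set_conv_nth by auto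
    then obtain q where "(c, k, q) \<in> es ! j" by (auto simp: deriv_def split: if_splits)
    then have "(c, k, q) \<in> V" using j(1) unfolding assms(1) mem_Union_set_conv_nth by blast
    then show ?thesis using only_delayed_or_presentD[OF assms(2)] by blast
  qed
  then show "only_delayed_or_present (snd (diff_system C (es, V)))"
    unfolding eq by (auto simp: only_delayed_or_present_def diff_system_def Let_def)
qed

text \<open>Blockedness agrees, so both steps are of the same kind. Two augmentations change only
  matching and row; two differentiations act on the same set of equations.\<close>

lemma in_step_step:
  assumes rel: "in_step D a s"
    and step: "differentiation_step (D, a) (D', a')" "dae_step (range Unknown) s s'"
  shows "in_step D' a' s'"
proof -
  have inv': "pantelides_inv UNIV a'" "pantelides_inv (range Unknown) s'"
    using rel pantelides_inv_step step differentiation_step_imp_dae_step[OF step(1)]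
    unfolding in_step_def by auto
  show ?thesis
  proof (cases "blocked (dae_match_graph UNIV) a")
    case False
    then have "augment_step (dae_match_graph UNIV) a a'" "D' = D"
      "augment_step (dae_match_graph (range Unknown)) s s'"
      using step in_step_blocked[OF rel] dae_diff_stepD(1)
      unfolding differentiation_step_def dae_step_def by auto
    then show ?thesis
      using rel inv' unfolding in_step_def by (auto elim!: augment_stepD)
  next
    case True
    define C where "C = blocked_set (dae_match_graph UNIV) a"
    have steps: "dae_diff_step UNIV a a'" "D' = diff_system C D" "dae_diff_step (range Unknown) s s'"
      using step True in_step_blocked[OF rel]
      unfolding differentiation_step_def dae_step_def C_def
      by (auto dest: augment_step_not_blocked)
    obtain es V where D: "D = (es, V)" by (cases D)
    have "fst D' = replace_eqs C (\<lambda>_. deriv) es"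
      by (simp add: steps(2) D diff_system_def Let_def)
    moreover have "eqs a' = map order_classes (replace_eqs C (\<lambda>_. deriv) es)"
      using dae_diff_stepD(4)[OF steps(1)] rel
      by (simp add: C_def in_step_def D replace_eqs_map[of order_classes deriv, OF order_classes_deriv])
    moreover have "eqs s' = map ((`) param_var) (replace_eqs C (\<lambda>_. deriv) es)"
      using dae_diff_stepD(4)[OF steps(3)] rel in_step_blocked_set[OF rel True]
      by (simp add: C_def in_step_def D replace_eqs_map[of "(`) param_var" deriv, OF param_var_deriv])
    moreover have "row a' = row s'"
      using dae_diff_stepD(2)[OF steps(1)] dae_diff_stepD(2)[OF steps(3)] rel
      by (simp add: in_step_def)
    ultimately show ?thesis
      using inv' in_step_diff_system[of V es C] rel
      unfolding in_step_def steps(2) D fst_conv snd_conv by metis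
  qed
qed

text \<open>A run ends exactly when its row reaches the number of equations, and related states
  agree in both numbers. Hence neither run can stop before the other.\<close>

lemma in_step_run:
  assumes "differentiation_step\<^sup>*\<^sup>* T T'" "\<And>T''. \<not> differentiation_step T' T''"
    and "(dae_step (range Unknown))\<^sup>*\<^sup>* s s'" "\<And>s''. \<not> dae_step (range Unknown) s' s''"
    and "in_step (fst T) (snd T) s"
  shows "in_step (fst T') (snd T') s'"
  using assms(1,3,5)
proof (induction arbitrary: s rule: converse_rtranclp_induct)
  case base
  have "length (eqs (snd T')) \<le> row (snd T')"
    using assms(2) differentiation_step_final[of "fst T'" "snd T'"] by simp
  then have "\<not> dae_step (range Unknown) s t" for t
    using in_step_row[OF base(2)] dae_step_final[of "range Unknown" s] by simp
  then have "s = s'" using base(1) by (metis converse_rtranclpE)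
  then show ?case using base(2) by simp
next
  case (step T T1)
  have "row (snd T) < length (eqs (snd T))"
    using step(1) differentiation_step_final[of "fst T" "snd T"] by (metis not_le prod.collapse)
  then have "s \<noteq> s'"
    using in_step_row[OF step(5)] dae_step_final[of "range Unknown" s'] assms(4) by auto
  then obtain s1 where s1: "dae_step (range Unknown) s s1" "(dae_step (range Unknown))\<^sup>*\<^sup>* s1 s'"
    using step(4) by (metis converse_rtranclpE)
  have "in_step (fst T1) (snd T1) s1"
    using in_step_step[OF step(5) _ s1(1)] step(1) by simp
  then show ?case using step(3) s1(2) by blast
qed

section \<open>Isomorphism of the resulting graphs\<close>

text \<open>The identity on equations and \<open>h\<close> on variables form the isomorphism. The
  predicates serve the full graphs (constantly true) and the graphs without delayed variables and
  parameters at once.\<close>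

lemma isomorphic_incidence_graph_image:
  assumes inj: "inj_on h V" and sub: "\<Union>(set es) \<subseteq> V" and Q: "\<And>v. v \<in> V \<Longrightarrow> Q' (h v) \<longleftrightarrow> Q v"
  shows "isomorphic (restrict_vars Q (incidence_graph es V (\<lambda>E v. v \<in> E)))
    (restrict_vars Q' (incidence_graph (map ((`) h) es) (h ` V) (\<lambda>E v. v \<in> E)))"
proof -
  have "h v \<in> h ` (es ! j) \<longleftrightarrow> v \<in> es ! j" if "j < length es" "v \<in> V" for j v
  proof (rule inj_on_image_mem_iff[OF inj that(2)])
    show "es ! j \<subseteq> V" using sub that(1) by (meson mem_Union_set_conv_nth subset_iff)
  qed
  moreover have "bij_betw h {v \<in> V. Q v} {w \<in> h ` V. Q' w}"
    using inj Q by (auto simp: bij_betw_def inj_on_def)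
  ultimately show ?thesis
    unfolding isomorphic_def
    by (intro exI[of _ id] exI[of _ h]) (auto simp: restrict_vars_def incidence_graph_def Q)
qed

lemma restrict_vars_True [simp]:
  "restrict_vars (\<lambda>_. True) (incidence_graph es W adj) = incidence_graph es W adj"
  by (simp add: restrict_vars_def incidence_graph_def)

theorem theorem5p4:
  fixes n :: nat and F :: "var set list"
  assumes "is_ddae n F"
    and "structurally_nonsingular F (Theta_bar n F) (R_equal (Theta_bar n F))"
  shows "ddae_terminates n F \<and> no_equation_shifted F \<and>
    dae_terminates (range Unknown) (replace_delayed F) \<and>
    (\<forall>G H. ddae_output n F G \<longrightarrow> dae_output (range Unknown) (replace_delayed F) H \<longrightarrow>
       isomorphic G H \<and>
       isomorphic (restrict_vars is_undelayed G) (restrict_vars is_unknown H))"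
proof -
  have delays: "only_delayed_or_present (\<Union>(set F))"
    unfolding only_delayed_or_present_def using is_ddaeD[OF assms(1)] by blast
  then have delays_nth: "only_delayed_or_present (F ! j)" if "j < length F" for j
    using that unfolding only_delayed_or_present_def by (meson mem_Union_set_conv_nth)
  have fin: "finite E" if "E \<in> set F" for E
    using is_ddae_finite[OF assms(1)] that by (meson Union_upper finite_subset)
  have fin_oc: "\<forall>E\<in>set (map order_classes F). finite E"
  proof -
    have "finite (order_classes E)" if "finite E" for E
    proof -
      have "order_classes E \<subseteq> (\<lambda>(c, k, p). (c, p)) ` E" by (force simp: order_classes_def)
      then show ?thesis using that by (rule finite_subset[OF _ finite_imageI])
    qed
    then show ?thesis using fin by simp
  qed
  have fin_pv: "\<forall>E\<in>set (replace_delayed F). finite E"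
    using fin by (simp add: replace_delayed_eq)
  have "component_hall UNIV (map order_classes F)"
    unfolding component_hall_def
  proof (intro allI impI)
    fix S assume "S \<subseteq> {..<length (map order_classes F)}"
    then have S: "S \<subseteq> {..<length F}" by simp
    then have "components UNIV (map order_classes F) S = {c. \<exists>j\<in>S. \<exists>p. (c, 0, p) \<in> F ! j}"
      using delays_nth unfolding components_def by (auto simp: mem_order_classes subset_iff)
    then show "card S \<le> card (components UNIV (map order_classes F) S)"
      using structurally_nonsingular_card_le[OF assms S] by simp
  qed
  then have "dae_terminates UNIV (map order_classes F)"
    by (rule pantelides_terminates[OF fin_oc])
  then have "ddae_terminates n F"
    using shifting_terminates[OF assms] after_linearization_eq[OF assms]
      terminates_differentiation_step
    unfolding ddae_terminates_def by simp
  moreover have "component_hall (range Unknown) (replace_delayed F)"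
    unfolding component_hall_def
  proof (intro allI impI)
    fix S assume "S \<subseteq> {..<length (replace_delayed F)}"
    then have S: "S \<subseteq> {..<length F}" by (simp add: replace_delayed_eq)
    \<comment> \<open>Parameters are not in \<open>range Unknown\<close>, so only undelayed
      variables count and the bound is the same as for the auxiliary graph.\<close>
    then have "components (range Unknown) (replace_delayed F) S =
        Unknown ` {c. \<exists>j\<in>S. \<exists>p. (c, 0, p) \<in> F ! j}"
    proof -
      have "(\<exists>p. (Unknown c, p) \<in> replace_delayed F ! j) \<longleftrightarrow> (\<exists>p. (c, 0, p) \<in> F ! j)"
        if "j \<in> S" for c j
        using that S delays_nth[of j] by (auto simp: replace_delayed_eq Unknown_mem_param_var subset_iff)
      then show ?thesis unfolding components_def by blast
    qed
    then show "card S \<le> card (components (range Unknown) (replace_delayed F) S)"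
      using structurally_nonsingular_card_le[OF assms S] by (simp add: card_image inj_on_def)
  qed
  then have "dae_terminates (range Unknown) (replace_delayed F)"
    by (rule pantelides_terminates[OF fin_pv])
  moreover have "isomorphic G H \<and>
      isomorphic (restrict_vars is_undelayed G) (restrict_vars is_unknown H)"
    if G: "ddae_output n F G" and H: "dae_output (range Unknown) (replace_delayed F) H" for G H
  proof -
    obtain s es V a where G': "yields shifting_step (ddae_start F) s"
        "yields differentiation_step (after_linearization n s) ((es, V), a)"
        "G = incidence_graph es V (\<lambda>E v. v \<in> E)"
      using G unfolding ddae_output_def by blast
    obtain t where H': "yields (dae_step (range Unknown)) (dae_start (replace_delayed F)) t"
        "H = incidence_graph (eqs t) (present t) (\<lambda>E v. v \<in> E)"
      using H unfolding dae_output_def by blast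
    have "in_step (F, \<Union>(set F)) (dae_start (map order_classes F)) (dae_start (replace_delayed F))"
      unfolding in_step_def
      using pantelides_inv_start[OF fin_oc] pantelides_inv_start[OF fin_pv] delays
      by (simp add: dae_start_def replace_delayed_eq)
    then have rel: "in_step (es, V) a t"
      using in_step_run[of "after_linearization n s" "((es, V), a)" "dae_start (replace_delayed F)" t]
        G'(2) H'(1) unfolding yields_def after_linearization_eq[OF assms G'(1)] by simp
    then have V: "V = \<Union>(set es)" "only_delayed_or_present V"
      and t: "eqs t = map ((`) param_var) es" "present t = \<Union>(set (eqs t))"
      unfolding in_step_def pantelides_inv_def fst_conv snd_conv by blast+
    then have "present t = param_var ` V" by auto
    then have H_eq: "H = incidence_graph (map ((`) param_var) es) (param_var ` V) (\<lambda>E v. v \<in> E)"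
      by (simp add: H'(2) t(1))
    note iso = isomorphic_incidence_graph_image[OF inj_on_param_var[OF V(2)] equalityD2[OF V(1)]]
    show ?thesis
      using iso[of "\<lambda>_. True" "\<lambda>_. True"] iso[of is_unknown is_undelayed] is_unknown_param_var[OF V(2)]
      unfolding G'(3) H_eq by simp
  qed
  ultimately show ?thesis using no_equation_shifted[OF assms] by blast
qed

end
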